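(* Let $\alpha'=\beta'=0$, let $\alpha,\beta>0$, and let $\gamma,\gamma'\ge0$ be real numbers. Let $X_n$ be the random variables associated with these parameters (see context), with mean $\mu_n=\mathbb{E}X_n$ and variance $\sigma_n^2=\operatorname{var}(X_n)$. Then $$\frac{X_n-\mu_n}{\sigma_n}\xrightarrow{d}\mathrm{N}(0,1)\quad\text{as } n\to\infty,$$ where $$\mu_n\sim\frac{(\gamma')^{\alpha/(\alpha+\beta)}}{\beta}(\alpha n)^{\beta/(\alpha+\beta)},\qquad \sigma_n^2\sim\frac{(\gamma')^{\alpha/(\alpha+\beta)}\,\alpha\,(\alpha n)^{\beta/(\alpha+\beta)}}{\beta(\alpha+\beta)}.$$
   Context: For real parameters $\alpha,\beta,\gamma,\alpha',\beta',\gamma'$, the numbers $\left|{n\atop k}\right|$, $0\le k\le n$, are defined by the recurrence $$\left|{n\atop k}\right|=(\alpha n+\beta k+\gamma)\left|{n-1\atop k}\right|+(\alpha' n+\beta' k+\gamma')\left|{n-1\atop k-1}\right|+I_{n=k=0},$$ with $\left|{n\atop k}\right|=0$ unless $0\le k\le n$; here $I_{n=k=0}$ equals $1$ if $n=k=0$ and $0$ otherwise, so $\left|{0\atop 0}\right|=1$. The random variable $X_n$ is the integer-valued random variable with $$\mathbb{P}(X_n=k)=\frac{\left|{n\atop k}\right|}{\sum_{j=0}^n\left|{n\atop j}\right|},\qquad 0\le k\le n.$$ $\xrightarrow{d}$ denotes convergence in distribution, $\mathrm{N}(0,1)$ is the standard normal distribution, and $a_n\sim b_n$ means $a_n/b_n\to1$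 as $n\to\infty$.
   Formalization: The formal theorem assumes γ' > 0 instead of γ' ≥ 0; for γ' = 0 one has X_n = 0 almost surely and σ_n = 0, so the normalized variable and both asymptotic ratios are 0/0 and the claim is undefined. *)

theory Defs
  imports "HOL-Probability.Probability" "HOL-Library.Landau_Symbols"
begin

text \<open>
  The triangular array with entries indexed by natural numbers \<open>n\<close> and \<open>k\<close>. The remaining
  boundary values (\<open>k > n\<close>) come out as \<open>0\<close> by themselves, see \<open>tri_eq_0\<close>; entries with
  a negative index are \<open>0\<close> by convention and have been dropped from the recurrence,
  see \<open>tri_rec\<close>.
\<close>

fun tri :: "real \<Rightarrow> real \<Rightarrow> real \<Rightarrow> real \<Rightarrow> real \<Rightarrow> real \<Rightarrow> nat \<Rightarrow> nat \<Rightarrow> real" where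
  "tri \<alpha> \<beta> \<gamma> \<alpha>' \<beta>' \<gamma>' 0 k = (if k = 0 then 1 else 0)"
| "tri \<alpha> \<beta> \<gamma> \<alpha>' \<beta>' \<gamma>' (Suc n) 0 =
     (\<alpha> * real (Suc n) + \<gamma>) * tri \<alpha> \<beta> \<gamma> \<alpha>' \<beta>' \<gamma>' n 0"
| "tri \<alpha> \<beta> \<gamma> \<alpha>' \<beta>' \<gamma>' (Suc n) (Suc k) =
     (\<alpha> * real (Suc n) + \<beta> * real (Suc k) + \<gamma>) * tri \<alpha> \<beta> \<gamma> \<alpha>' \<beta>' \<gamma>' n (Suc k)
     + (\<alpha>' * real (Suc n) + \<beta>' * real (Suc k) + \<gamma>') * tri \<alpha> \<beta> \<gamma> \<alpha>' \<beta>' \<gamma>' n k"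

lemma tri_eq_0: "n < k \<Longrightarrow> tri \<alpha> \<beta> \<gamma> \<alpha>' \<beta>' \<gamma>' n k = 0"
  by (induction \<alpha> \<beta> \<gamma> \<alpha>' \<beta>' \<gamma>' n k rule: tri.induct) auto

lemma tri_rec:
  "tri \<alpha> \<beta> \<gamma> \<alpha>' \<beta>' \<gamma>' n k =
     (\<alpha> * real n + \<beta> * real k + \<gamma>)
       * (if n = 0 then 0 else tri \<alpha> \<beta> \<gamma> \<alpha>' \<beta>' \<gamma>' (n - 1) k)
     + (\<alpha>' * real n + \<beta>' * real k + \<gamma>')
       * (if n = 0 \<or> k = 0 then 0 else tri \<alpha> \<beta> \<gamma> \<alpha>' \<beta>' \<gamma>' (n - 1) (k - 1))
     + (if n = 0 \<and> k = 0 then 1 else 0)"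
  by (cases n; cases k) auto

end

theory Submission
  imports Defs "HOL-Computational_Algebra.Fundamental_Theorem_Algebra" "HOL-Real_Asymp.Real_Asymp"
begin

text \<open>
  All zeros of the row polynomial \<open>P\<^sub>n(w) = \<Sum>k. |n k| w^k\<close> are real and negative: the
  recurrence reads \<open>P\<^sub>n = P\<^sub>n\<^sub>-\<^sub>1 \<cdot> (\<alpha> n + \<gamma> + \<gamma>' w + \<beta> w P\<^sub>n\<^sub>-\<^sub>1' / P\<^sub>n\<^sub>-\<^sub>1)\<close>, and if the zeros of \<open>P\<^sub>n\<^sub>-\<^sub>1\<close> are
  negative then the second factor maps the upper half plane into itself. Hence \<open>X\<^sub>n\<close> is
  distributed as a sum of independent Bernoulli variables, and it is asymptotically normal as soon
  as its variance tends to infinity.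

  For the moments, a Dobinski type formula expresses \<open>exp (c w) P\<^sub>n(w)\<close>, \<open>c = \<gamma>' / \<beta>\<close>, as a power
  series with explicit positive coefficients, which gives the leading term of \<open>ln P\<^sub>n(w)\<close>
  for every \<open>w > 0\<close>. As \<open>ln P\<^sub>n(w)\<close> and \<open>w P\<^sub>n'(w) / P\<^sub>n(w) = \<Sum> w / (w + r\<^sub>i)\<close> are concave in \<open>w\<close>, these limits may be
  differentiated twice, which yields the mean and the variance.
\<close>

section \<open>Real-rootedness\<close>

text \<open>The logarithmic derivative of a product of linear factors, multiplied out. It is applied
  over the complex numbers to locate zeros and over the reals to compute the mean.\<close>

lemma poly_pderiv_prod_linear:
  fixes z :: "'a :: field_char_0" and n :: nat
  assumes "\<And>i. i < n \<Longrightarrow> z + r i \<noteq> 0"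
  shows "poly (pderiv (\<Prod>i<n. [:r i, 1:])) z
    = poly (\<Prod>i<n. [:r i, 1:]) z * (\<Sum>i<n. 1 / (z + r i))"
  using assms
proof (induction n)
  case (Suc n)
  have nz: "r n + z \<noteq> 0" using Suc.prems[of n] by (simp add: add.commute)
  define Q where "Q = poly (\<Prod>i<n. [:r i, 1:]) z"
  define S where "S = (\<Sum>i<n. 1 / (z + r i))"
  have "poly (pderiv (\<Prod>i<n. [:r i, 1:])) z = Q * S"
    unfolding Q_def S_def using Suc by simp
  then have "poly (pderiv (\<Prod>i<Suc n. [:r i, 1:])) z = Q + Q * S * (r n + z)"
    by (simp add: pderiv_mult pderiv_pCons pderiv_add pderiv_smult Q_def algebra_simps)
  also have "\<dots> = Q * (r n + z) * (S + 1 / (r n + z))"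
    using nz by (simp add: divide_simps) (simp add: algebra_simps)
  finally show ?case by (simp add: Q_def S_def add.commute distrib_left distrib_right mult_ac)
qed simp

text \<open>Multiplying numerator and denominator by the conjugate of \<open>z + r\<close> leaves
  \<open>|z|^2 + r z\<close> on top, so for \<open>r > 0\<close> the quotient stays in the half
  plane of \<open>z\<close>.\<close>

lemma Im_divide_self_add_of_real:
  assumes "z + complex_of_real r \<noteq> 0"
  shows "Im (z / (z + of_real r)) = Im z * (r / (cmod (z + of_real r))\<^sup>2)"
  unfolding cmod_power2 by (simp add: Im_divide algebra_simps)

text \<open>With \<open>\<gamma>' > 0\<close> the diagonal entries are positive, so row
  \<open>n\<close> has exact degree \<open>n\<close>; for \<open>\<gamma>' = 0\<close> the random
  variable would be almost surely 0.\<close>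

locale triangle =
  fixes \<alpha> \<beta> \<gamma> \<gamma>' :: real
  assumes pos: "\<alpha> > 0" "\<beta> > 0" "\<gamma> \<ge> 0" "\<gamma>' > 0"
begin

abbreviation T :: "nat \<Rightarrow> nat \<Rightarrow> real" where
  "T \<equiv> tri \<alpha> \<beta> \<gamma> 0 0 \<gamma>'"

lemma T_nonneg: "T n k \<ge> 0"
  using pos by (induction \<alpha> \<beta> \<gamma> "0::real" "0::real" \<gamma>' n k rule: tri.induct) auto

lemma T_0_pos: "T n 0 > 0"
  using pos by (induction n) (auto simp: add_pos_nonneg)

lemma T_diag_pos: "T n n > 0"
  using pos by (induction n) (auto simp: tri_eq_0)

text \<open>Complex coefficients, because the splitting into linear factors is taken over an
  algebraically closed field.\<close>

definition tri_poly :: "nat \<Rightarrow> complex poly" where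
  "tri_poly n = (\<Sum>k\<le>n. monom (of_real (T n k)) k)"

lemma coeff_tri_poly: "coeff (tri_poly n) k = of_real (T n k)"
proof -
  have "coeff (tri_poly n) k = (\<Sum>j\<le>n. if j = k then of_real (T n j) else 0)"
    unfolding tri_poly_def coeff_sum by (intro sum.cong) auto
  also have "\<dots> = of_real (T n k)"
    by (auto simp: tri_eq_0 not_le)
  finally show ?thesis .
qed

lemma degree_tri_poly: "degree (tri_poly n) = n"
proof (rule antisym)
  show "degree (tri_poly n) \<le> n"
    by (rule degree_le) (auto simp: coeff_tri_poly tri_eq_0)
  show "n \<le> degree (tri_poly n)"
    using T_diag_pos[of n] by (intro le_degree) (simp add: coeff_tri_poly)
qed

lemma poly_tri_poly: "poly (tri_poly n) z = (\<Sum>k\<le>n. of_real (T n k) * z ^ k)"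
  by (simp add: poly_altdef degree_tri_poly coeff_tri_poly)

text \<open>The weight \<open>\<beta> k\<close> on the coefficients is the operator
  \<open>\<beta> w d/dw\<close>; \<open>pCons 0\<close> is multiplication by
  \<open>w\<close>.\<close>

lemma tri_poly_Suc:
  "tri_poly (Suc n) = [:of_real (\<alpha> * real (Suc n) + \<gamma>), of_real \<gamma>':] * tri_poly n
    + smult (of_real \<beta>) (pCons 0 (pderiv (tri_poly n)))"
proof (rule poly_eqI)
  fix k
  show "coeff (tri_poly (Suc n)) k = coeff ([:of_real (\<alpha> * real (Suc n) + \<gamma>), of_real \<gamma>':] * tri_poly n
    + smult (of_real \<beta>) (pCons 0 (pderiv (tri_poly n)))) k"
    by (cases k) (simp_all add: coeff_tri_poly coeff_pderiv algebra_simps)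
qed

lemma poly_tri_poly_nonneg_real:
  assumes "x \<ge> 0"
  shows "poly (tri_poly n) (of_real x) \<noteq> 0"
proof -
  have "poly (tri_poly n) (of_real x) = of_real (\<Sum>k\<le>n. T n k * x ^ k)"
    by (simp add: poly_tri_poly)
  moreover have "(\<Sum>k\<le>n. T n k * x ^ k) \<ge> (\<Sum>k\<in>{0}. T n k * x ^ k)"
    using T_nonneg assms by (intro sum_mono2) auto
  then have "(\<Sum>k\<le>n. T n k * x ^ k) \<noteq> 0" using T_0_pos[of n] by simp
  ultimately show ?thesis by (metis of_real_eq_0_iff)
qed

text \<open>Induction on the row: non-real zeros of the next row are excluded by the half plane
  argument, nonnegative real ones by the signs of the coefficients. Splitting over the complex
  numbers then yields only real factors.\<close>

lemma tri_poly_factorization: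
  "\<exists>r. (\<forall>i<n. r i > 0) \<and>
    tri_poly n = smult (of_real (T n n)) (\<Prod>i<n. [:of_real (r i), 1:])"
proof (induction n)
  case 0
  show ?case by (auto simp: tri_poly_def)
next
  case (Suc n)
  then obtain r where r: "\<And>i. i < n \<Longrightarrow> r i > 0"
    and P: "tri_poly n = smult (of_real (T n n)) (\<Prod>i<n. [:complex_of_real (r i), 1:])" by blast
  have root: "Im z = 0 \<and> Re z < 0" if z: "poly (tri_poly (Suc n)) z = 0" for z
  proof
    show "Im z = 0"
    proof (rule ccontr)
      assume im: "Im z \<noteq> 0"
      have nz: "z + of_real (r i) \<noteq> 0" for i
        using im by (auto simp: complex_eq_iff)
      have nz': "poly (tri_poly n) z \<noteq> 0"
        using T_diag_pos[of n] nz unfolding P by (simp add: poly_prod add.commute)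
      \<comment> \<open>\<open>S\<close> is the quotient of two consecutive row polynomials at
        \<open>z\<close>.\<close>
      define S where "S = of_real (\<alpha> * real (Suc n) + \<gamma>) + of_real \<gamma>' * z
        + of_real \<beta> * (\<Sum>i<n. z / (z + of_real (r i)))"
      have "poly (pderiv (tri_poly n)) z = poly (tri_poly n) z * (\<Sum>i<n. 1 / (z + of_real (r i)))"
        unfolding P pderiv_smult using poly_pderiv_prod_linear[of n z "\<lambda>i. of_real (r i)"] nz by simp
      then have "poly (tri_poly (Suc n)) z = poly (tri_poly n) z * S"
        unfolding tri_poly_Suc S_def by (simp add: algebra_simps sum_distrib_left)
      then have "S = 0" using z nz' by simp
      \<comment> \<open>Every summand contributes an imaginary part with the sign of
        \<open>Im z\<close>, and the term \<open>\<gamma>' z\<close> makes the total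
        nonzero.\<close>
      moreover have "Im S = Im z * (\<gamma>' + \<beta> * (\<Sum>i<n. r i / (cmod (z + of_real (r i)))\<^sup>2))"
      proof -
        define R where "R = (\<Sum>i<n. z / (z + of_real (r i)))"
        have "Im R = Im z * (\<Sum>i<n. r i / (cmod (z + of_real (r i)))\<^sup>2)"
          unfolding R_def Im_sum Im_divide_self_add_of_real[OF nz] sum_distrib_left ..
        then show ?thesis
          unfolding S_def R_def[symmetric] by (simp add: algebra_simps)
      qed
      moreover have "(\<Sum>i<n. r i / (cmod (z + of_real (r i)))\<^sup>2) \<ge> 0"
        using r by (intro sum_nonneg) (auto simp: less_imp_le)
      then have "\<gamma>' + \<beta> * (\<Sum>i<n. r i / (cmod (z + of_real (r i)))\<^sup>2) > 0"
        using pos by (intro add_pos_nonneg) auto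
      ultimately show False using im by simp
    qed
    then have "z = of_real (Re z)" by (simp add: complex_eq_iff)
    then show "Re z < 0" using poly_tri_poly_nonneg_real[of "Re z" "Suc n"] z by force
  qed
  have "tri_poly (Suc n) \<noteq> 0" using degree_tri_poly[of "Suc n"] by auto
  then obtain A where A: "size A = Suc n"
      "tri_poly (Suc n) = smult (of_real (T (Suc n) (Suc n))) (\<Prod>x\<in>#A. [:-x, 1:])"
    using alg_closed_imp_factorization[of "tri_poly (Suc n)"]
    unfolding degree_tri_poly coeff_tri_poly by blast
  \<comment> \<open>Listing the multiset indexes the zeros by \<open>i < Suc n\<close>, with
    multiplicity.\<close>
  obtain xs where xs: "A = mset xs" by (metis ex_mset)
  have len: "length xs = Suc n" using A xs by simp
  have xs_root: "poly (tri_poly (Suc n)) (xs ! i) = 0" if "i < Suc n" for i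
  proof -
    have "[:- (xs ! i), 1:] dvd (\<Prod>x\<in>#A. [:-x, 1:])"
      using that by (intro dvd_prod_mset) (auto simp: xs len)
    then have "[:- (xs ! i), 1:] dvd tri_poly (Suc n)" unfolding A(2) by (rule dvd_smult)
    then show ?thesis by (simp add: poly_eq_0_iff_dvd)
  qed
  have "(\<Prod>x\<in>#A. [:-x, 1:]) = (\<Prod>i<Suc n. [:- (xs ! i), 1:])"
    unfolding xs mset_map[symmetric] prod_mset_prod_list
    by (simp add: prod.list_conv_set_nth len atLeast0LessThan del: prod.lessThan_Suc)
  also have "\<dots> = (\<Prod>i<Suc n. [:of_real (- Re (xs ! i)), 1:])"
    using root[OF xs_root] by (intro prod.cong) (auto simp: complex_eq_iff)
  finally have "tri_poly (Suc n) = smult (of_real (T (Suc n) (Suc n))) (\<Prod>i<Suc n. [:of_real (- Re (xs ! i)), 1:])"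
    using A(2) by simp
  then show ?case using root[OF xs_root]
    by (intro exI[of _ "\<lambda>i. - Re (xs ! i)"]) auto
qed

text \<open>The zeros of row \<open>n\<close> are \<open>- neg_root n i\<close> with
  \<open>i < n\<close>, in an arbitrary order fixed by choice; only symmetric expressions in them
  matter later.\<close>

definition neg_root :: "nat \<Rightarrow> nat \<Rightarrow> real" where
  "neg_root n = (SOME r. (\<forall>i<n. r i > 0) \<and>
    tri_poly n = smult (of_real (T n n)) (\<Prod>i<n. [:of_real (r i), 1:]))"

lemma neg_root_pos: "i < n \<Longrightarrow> neg_root n i > 0"
  and tri_poly_factor:
    "tri_poly n = smult (of_real (T n n)) (\<Prod>i<n. [:of_real (neg_root n i), 1:])"
  using someI_ex[OF tri_poly_factorization[of n], folded neg_root_def] by blast+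

lemma row_poly_factor:
  "(\<Sum>k\<le>n. complex_of_real (T n k) * z ^ k) = of_real (T n n) * (\<Prod>i<n. z + of_real (neg_root n i))"
  unfolding poly_tri_poly[symmetric]
  by (subst tri_poly_factor) (simp add: poly_prod add.commute)

definition row_sum :: "nat \<Rightarrow> real \<Rightarrow> real" where
  "row_sum n w = (\<Sum>k\<le>n. T n k * w ^ k)"

lemma row_sum_factor: "row_sum n x = T n n * (\<Prod>i<n. x + neg_root n i)"
proof -
  have "complex_of_real (row_sum n x) = of_real (T n n * (\<Prod>i<n. x + neg_root n i))"
    using row_poly_factor[of n "of_real x"] by (simp add: row_sum_def)
  then show ?thesis by (simp only: of_real_eq_iff)
qed

end

section \<open>A Dobinski type formula\<close>

context triangle
begin

abbreviation (input) c :: real where "c \<equiv> \<gamma>' / \<beta>"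

text \<open>The row polynomial times \<open>exp (c * w)\<close> has these power series coefficients: the
  factor removes the shift in the recurrence and leaves a pure product.\<close>

lemma exp_convolution:
  "(\<Sum>k\<le>j. T n k * (c ^ (j - k) / fact (j - k)))
    = c ^ j / fact j * (\<Prod>i=1..n. \<alpha> * real i + \<beta> * real j + \<gamma>)"
proof (induction n)
  case 0
  have "(\<Sum>k\<le>j. T 0 k * (c ^ (j - k) / fact (j - k)))
    = (\<Sum>k\<le>j. if k = 0 then c ^ j / fact j else 0)"
    by (intro sum.cong) auto
  then show ?case by simp
next
  case (Suc n)
  define e where "e m = c ^ m / fact m" for m
  \<comment> \<open>The constant \<open>c\<close> is chosen for this relation: it turns the shifted
    term of the recurrence into one with weight \<open>\<beta> (j - k)\<close>.\<close>
  have e_Suc: "\<beta> * (real (Suc m) * e (Suc m)) = \<gamma>' * e m" for m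
  proof -
    have "e (Suc m) = c / real (Suc m) * e m" by (simp add: e_def del: of_nat_Suc)
    then show ?thesis using pos by (simp del: of_nat_Suc)
  qed
  have "(\<Sum>k\<le>j. T (Suc n) k * e (j - k))
    = (\<Sum>k\<le>j. (\<alpha> * real (Suc n) + \<beta> * real k + \<gamma>) * T n k * e (j - k))
      + (\<Sum>k\<le>j. if k = 0 then 0 else \<gamma>' * T n (k - 1) * e (j - k))"
    unfolding sum.distrib[symmetric]
  proof (intro sum.cong refl)
    fix k show "T (Suc n) k * e (j - k) = (\<alpha> * real (Suc n) + \<beta> * real k + \<gamma>) * T n k * e (j - k)
      + (if k = 0 then 0 else \<gamma>' * T n (k - 1) * e (j - k))"
      by (cases k) (simp_all add: algebra_simps)
  qed
  also have "(\<Sum>k\<le>j. if k = 0 then 0 else \<gamma>' * T n (k - 1) * e (j - k))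
    = (\<Sum>k<j. \<gamma>' * T n k * e (j - Suc k))"
    by (cases j) (simp_all add: sum.atMost_Suc_shift lessThan_Suc_atMost del: sum.atMost_Suc)
  also have "\<dots> = (\<Sum>k<j. \<beta> * real (j - k) * T n k * e (j - k))"
  proof (intro sum.cong refl)
    fix k assume "k \<in> {..<j}"
    then have "j - k = Suc (j - Suc k)" by auto
    then show "\<gamma>' * T n k * e (j - Suc k) = \<beta> * real (j - k) * T n k * e (j - k)"
      using e_Suc[of "j - Suc k"] by (simp add: mult_ac)
  qed
  \<comment> \<open>The added term \<open>k = j\<close> carries the factor 0.\<close>
  also have "\<dots> = (\<Sum>k\<le>j. \<beta> * real (j - k) * T n k * e (j - k))"
    by (simp add: lessThan_Suc_atMost[symmetric])
  \<comment> \<open>The weights \<open>\<beta> k\<close> and \<open>\<beta> (j - k)\<close> add up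
    to \<open>\<beta> j\<close>, which is independent of \<open>k\<close> and leaves the
    sum.\<close>
  also have "(\<Sum>k\<le>j. (\<alpha> * real (Suc n) + \<beta> * real k + \<gamma>) * T n k * e (j - k)) + \<dots>
    = (\<Sum>k\<le>j. (\<alpha> * real (Suc n) + \<beta> * real j + \<gamma>) * (T n k * e (j - k)))"
    unfolding sum.distrib[symmetric]
    by (intro sum.cong refl) (simp add: of_nat_diff algebra_simps)
  also have "\<dots> = (\<alpha> * real (Suc n) + \<beta> * real j + \<gamma>) * (\<Sum>k\<le>j. T n k * e (j - k))"
    by (simp add: sum_distrib_left)
  finally show ?case using Suc by (simp add: e_def mult_ac)
qed

text \<open>Cauchy product of the row polynomial, read as a power series with finitely many nonzero
  terms, and the exponential series; \<open>exp_convolution\<close> evaluates the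
  coefficients.\<close>

lemma exp_row_sum_sums:
  "(\<lambda>j. (c * w) ^ j / fact j * (\<Prod>i=1..n. \<alpha> * real i + \<beta> * real j + \<gamma>)) sums
    (row_sum n w * exp (c * w))"
proof -
  have fin: "\<And>k. k \<notin> {..n} \<Longrightarrow> T n k * w ^ k = 0" by (simp add: tri_eq_0)
  have 1: "summable (\<lambda>k. norm (T n k * w ^ k))"
    using fin by (intro summable_finite[of "{..n}"]) auto
  have 2: "summable (\<lambda>k. norm ((c * w) ^ k / fact k))"
    using summable_norm_exp[of "c * w"] by (simp add: field_simps)
  have "(\<Sum>k. T n k * w ^ k) = row_sum n w"
    unfolding row_sum_def using fin by (intro suminf_finite) auto
  moreover have "(\<Sum>k. (c * w) ^ k / fact k) = exp (c * w)"
    unfolding exp_def by (simp add: field_simps)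
  ultimately have "(\<lambda>j. \<Sum>k\<le>j. T n k * w ^ k * ((c * w) ^ (j - k) / fact (j - k)))
      sums (row_sum n w * exp (c * w))"
    using Cauchy_product_sums[OF 1 2] by simp
  moreover have "(\<Sum>k\<le>j. T n k * w ^ k * ((c * w) ^ (j - k) / fact (j - k)))
    = (c * w) ^ j / fact j * (\<Prod>i=1..n. \<alpha> * real i + \<beta> * real j + \<gamma>)" for j
  proof -
    have "(\<Sum>k\<le>j. T n k * w ^ k * ((c * w) ^ (j - k) / fact (j - k)))
      = (\<Sum>k\<le>j. w ^ j * (T n k * (c ^ (j - k) / fact (j - k))))"
    proof (intro sum.cong refl)
      fix k assume "k \<in> {..j}"
      then have "w ^ j = w ^ k * w ^ (j - k)" by (simp flip: power_add)
      then show "T n k * w ^ k * ((c * w) ^ (j - k) / fact (j - k))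
        = w ^ j * (T n k * (c ^ (j - k) / fact (j - k)))"
        by (simp only: power_mult_distrib) simp
    qed
    also have "\<dots> = w ^ j * (\<Sum>k\<le>j. T n k * (c ^ (j - k) / fact (j - k)))"
      by (simp add: sum_distrib_left)
    finally show ?thesis unfolding exp_convolution by (simp add: power_mult_distrib power_divide)
  qed
  ultimately show ?thesis by simp
qed

end


section \<open>Bounds for the coefficients\<close>

text \<open>This is the generalized binomial coefficient \<open>n + y\<close> over
  \<open>n\<close>.\<close>

definition rising :: "nat \<Rightarrow> real \<Rightarrow> real" where
  "rising n y = (\<Prod>i=1..n. 1 + y / real i)"

lemma rising_pos: "y \<ge> 0 \<Longrightarrow> rising n y > 0"
  unfolding rising_def by (intro prod_pos) (auto intro: add_pos_nonneg)

lemma rising_mono: "0 \<le> x \<Longrightarrow> x \<le> y \<Longrightarrow> rising n x \<le> rising n y"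
  unfolding rising_def by (intro prod_mono) (auto simp: divide_right_mono)

text \<open>Negating the upper index makes \<open>rising n y\<close> a coefficient in the binomial
  series of \<open>(1 - x) powr (- (y + 1))\<close>.\<close>

lemma rising_eq_gchoose: "rising n y = (-1) ^ n * ((- (y + 1)) gchoose n)"
proof (induction n)
  case (Suc n)
  define G where "G = (- (y + 1)) gchoose n"
  define H where "H = (- (y + 1)) gchoose Suc n"
  define N where "N = real (Suc n)"
  have N: "N \<noteq> 0" by (simp add: N_def)
  have "N * H = - (G * (N + y))"
    using gbinomial_mult_1[of "- (y + 1)" n] by (simp add: G_def H_def N_def algebra_simps)
  then have "H = - (G * (1 + y / real (Suc n)))"
    unfolding N_def[symmetric] using N by (simp add: field_simps)
  moreover have "rising (Suc n) y = rising n y * (1 + y / real (Suc n))"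
    by (simp add: rising_def)
  ultimately show ?case unfolding H_def[symmetric] using Suc by (simp add: G_def)
qed (simp add: rising_def)

text \<open>The binomial series at \<open>1 - \<delta>\<close> has positive terms, so each one is at
  most the whole sum.\<close>

lemma rising_le:
  assumes "y \<ge> 0" "0 < \<delta>" "\<delta> < 1"
  shows "rising n y * (1 - \<delta>) ^ n \<le> \<delta> powr (- (y + 1))"
proof -
  have "(\<lambda>n. ((- (y + 1)) gchoose n) * (- (1 - \<delta>)) ^ n) sums (1 + - (1 - \<delta>)) powr (- (y + 1))"
    using assms by (intro gen_binomial_real) auto
  then have s: "(\<lambda>n. rising n y * (1 - \<delta>) ^ n) sums \<delta> powr (- (y + 1))"
    by (subst (asm) power_minus) (simp add: rising_eq_gchoose mult_ac)
  have "(\<Sum>m\<in>{n}. rising m y * (1 - \<delta>) ^ m) \<le> (\<Sum>m. rising m y * (1 - \<delta>) ^ m)"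
    using assms s rising_pos[OF assms(1)] by (intro sum_le_suminf) (auto simp: sums_iff less_imp_le)
  then show ?thesis using s by (simp add: sums_iff)
qed

text \<open>The derivative of \<open>(s + x) ln (s + x) - s ln s\<close> is
  \<open>ln (1 + x / s)\<close>, which decreases in \<open>s\<close>; the mean value theorem bounds
  the increment by the value at the left end.\<close>

lemma x_ln_x_increment_le:
  fixes t x :: real
  assumes "0 < t" "0 \<le> x"
  shows "((t + 1 + x) * ln (t + 1 + x) - (t + 1) * ln (t + 1)) - ((t + x) * ln (t + x) - t * ln t)
    \<le> ln (1 + x / t)"
proof -
  define h where "h s = (s + x) * ln (s + x) - s * ln s" for s :: real
  have "\<exists>z. t < z \<and> z < t + 1 \<and> h (t + 1) - h t = (t + 1 - t) * (ln (z + x) - ln z)"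
    unfolding h_def using assms by (intro MVT2) (auto intro!: derivative_eq_intros)
  then obtain z where z: "t < z" "h (t + 1) - h t = ln (z + x) - ln z" by auto
  have "ln (z + x) - ln z = ln (1 + x / z)"
  proof -
    have "1 + x / z = (z + x) / z" using assms z by (simp add: field_simps)
    then show ?thesis using assms z by (simp add: ln_div)
  qed
  also have "\<dots> \<le> ln (1 + x / t)"
    using assms z by (intro ln_mono add_left_mono divide_left_mono add_pos_nonneg) auto
  finally show ?thesis using z by (simp add: h_def)
qed

text \<open>The increment bound telescopes, which compares the sum of \<open>ln (1 + x / i)\<close>
  with an integral. Both sides agree at \<open>n = 0\<close>.\<close>

lemma ln_rising_ge:
  assumes "x \<ge> 0"
  shows "ln (rising n x) \<ge> (real n + 1 + x) * ln (real n + 1 + x)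
    - (real n + 1) * ln (real n + 1) - (1 + x) * ln (1 + x)"
proof (induction n)
  case (Suc n)
  have "rising (Suc n) x = rising n x * (1 + x / (real n + 1))"
    by (simp add: rising_def add.commute)
  moreover have "1 + x / (real n + 1) > 0" using assms by (intro add_pos_nonneg) auto
  ultimately have "ln (rising (Suc n) x) = ln (rising n x) + ln (1 + x / (real n + 1))"
    using rising_pos[OF assms, of n] by (simp add: ln_mult)
  with Suc x_ln_x_increment_le[of "real n + 1" x] assms show ?case by (simp add: algebra_simps)
qed (simp add: rising_def)

text \<open>Applying \<open>ln u \<le> u - 1\<close> at \<open>u = N / (N + x)\<close> leaves
  \<open>n\<close> only inside \<open>ln (n + 1)\<close>.\<close>

lemma ln_rising_ge_simple:
  assumes "x \<ge> 0"
  shows "ln (rising n x) \<ge> x * ln (real n + 1) + x - (1 + x) * ln (1 + x)" 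
proof -
  define N where "N = real n + 1"
  have N: "N > 0" by (simp add: N_def)
  have "- ln ((N + x) / N) \<le> N / (N + x) - 1"
    using ln_le_minus_one[of "N / (N + x)"] N assms by (simp add: ln_div)
  then have "(N + x) * (- ln ((N + x) / N)) \<le> (N + x) * (N / (N + x) - 1)"
    using N assms by (intro mult_left_mono) auto
  also have "\<dots> = - x" using N assms by (simp add: field_simps)
  finally have "(N + x) * ln (N + x) - (N + x) * ln N \<ge> x"
    using N assms by (simp add: ln_div algebra_simps)
  then have "x * ln N + x \<le> (N + x) * ln (N + x) - N * ln N" by (simp add: algebra_simps)
  with ln_rising_ge[OF assms, of n] show ?thesis by (simp add: N_def algebra_simps)
qed

text \<open>A weak Stirling bound; its error is logarithmic in \<open>j\<close>, hence negligible
  against a positive power of \<open>n\<close>.\<close>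

lemma ln_fact_le: "ln (fact j) \<le> (real j + 1) * ln (real j + 1) - real j"
proof (induction j)
  case (Suc j)
  define N where "N = real j + 1"
  have N: "N > 0" by (simp add: N_def)
  have "- ln ((N + 1) / N) \<le> N / (N + 1) - 1"
    using ln_le_minus_one[of "N / (N + 1)"] N by (simp add: ln_div)
  then have "(N + 1) * (- ln ((N + 1) / N)) \<le> (N + 1) * (N / (N + 1) - 1)"
    using N by (intro mult_left_mono) auto
  also have "\<dots> = - 1" using N by (simp add: field_simps)
  finally have "(N + 1) * ln (N + 1) - (N + 1) * ln N \<ge> 1"
    using N by (simp add: ln_div algebra_simps)
  moreover have "ln (fact (Suc j)) = ln N + ln (fact j :: real)"
    by (simp add: N_def ln_mult add.commute)
  ultimately show ?case using Suc by (simp add: N_def[symmetric] algebra_simps) (simp add: N_def algebra_simps)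
qed simp

section \<open>Growth of the row polynomials\<close>

text \<open>The tangent inequality at \<open>y = x + h\<close> places \<open>D n\<close> above the
  difference quotient of \<open>f n\<close> for \<open>h > 0\<close> and below it for
  \<open>h < 0\<close>. These quotients tend to those of \<open>F\<close>, which approximate
  \<open>d\<close>.\<close>

lemma tendsto_supergradient:
  fixes f :: "nat \<Rightarrow> real \<Rightarrow> real"
  assumes tangent: "\<And>n y. y > 0 \<Longrightarrow> f n y \<le> f n x + D n * (y - x)"
    and lim: "\<And>y. y > 0 \<Longrightarrow> (\<lambda>n. f n y) \<longlonglongrightarrow> F y"
    and deriv: "(F has_real_derivative d) (at x)" and x: "x > 0"
  shows "D \<longlonglongrightarrow> d"
proof (rule order_tendstoI)
  have quot: "((\<lambda>h. (F (x + h) - F x) / h) \<longlongrightarrow> d) (at 0)"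
    using deriv by (simp add: DERIV_def)
  have pos: "eventually (\<lambda>h. x + h > 0) (at 0)"
    using x by real_asymp
  {
    fix b assume "b < d"
    from order_tendstoD(1)[OF quot this] pos
    have "eventually (\<lambda>h. b < (F (x + h) - F x) / h \<and> x + h > 0) (at_right 0)"
      by (simp add: eventually_at_split eventually_conj_iff)
    from eventually_happens'[OF _ eventually_conj[OF this eventually_at_right_less[of 0]]]
    obtain h where h: "b < (F (x + h) - F x) / h" "x + h > 0" "h > 0" by auto
    have "(\<lambda>n. (f n (x + h) - f n x) / h) \<longlonglongrightarrow> (F (x + h) - F x) / h"
      using lim h x by (intro tendsto_intros) auto
    from order_tendstoD(1)[OF this h(1)]
    show "eventually (\<lambda>n. b < D n) sequentially"
    proof eventually_elim
      case (elim n)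
      have "(f n (x + h) - f n x) / h \<le> D n"
        using tangent[OF h(2), of n] h(3) by (simp add: field_simps)
      with elim show ?case by simp
    qed
  }
  {
    fix b assume "b > d"
    from order_tendstoD(2)[OF quot this] pos
    have "eventually (\<lambda>h. b > (F (x + h) - F x) / h \<and> x + h > 0) (at_left 0)"
      by (simp add: eventually_at_split eventually_conj_iff)
    moreover have "eventually (\<lambda>h::real. h < 0) (at_left 0)"
      by (simp add: eventually_at_filter)
    ultimately have "eventually (\<lambda>h. (b > (F (x + h) - F x) / h \<and> x + h > 0) \<and> h < 0) (at_left 0)"
      by (rule eventually_conj)
    from eventually_happens'[OF _ this]
    obtain h where h: "b > (F (x + h) - F x) / h" "x + h > 0" "h < 0" by auto
    have "(\<lambda>n. (f n (x + h) - f n x) / h) \<longlonglongrightarrow> (F (x + h) - F x) / h"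
      using lim h x by (intro tendsto_intros) auto
    from order_tendstoD(2)[OF this h(1)]
    show "eventually (\<lambda>n. D n < b) sequentially"
    proof eventually_elim
      case (elim n)
      have "D n \<le> (f n (x + h) - f n x) / h"
        using tangent[OF h(2), of n] h(3) by (simp add: field_simps)
      with elim show ?case by simp
    qed
  }
qed

section \<open>Limits of the elementary expressions in the saddle point bounds\<close>

lemma saddle_limit_linear:
  fixes k d :: real assumes "0 < k" "k < 1" "d > 0" 
  shows "(\<lambda>n::nat. - (real n * ln (1 - d * real n powr (k - 1))) / real n powr k) \<longlonglongrightarrow> d"
  using assms by real_asymp

lemma saddle_limit_ln:
  fixes k d :: real assumes "0 < k" "k < 1" "d > 0" 
  shows "(\<lambda>n::nat. ln (d * real n powr (k - 1)) / real n powr k) \<longlonglongrightarrow> 0"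
  using assms by real_asymp

text \<open>Pairing each logarithm with \<open>k ln n\<close> makes the two brackets tend to
  \<open>ln J\<close> and \<open>ln (a J)\<close>; the remaining logarithmic terms are of lower
  order.\<close>

lemma saddle_limit_index:
  fixes k J a :: real assumes "0 < k" "k < 1" "J > 0" "a > 0"
  shows "(\<lambda>n::nat. (J * real n powr k * (1 + a) - (1 + a) + J * real n powr k * a * (ln (real n + 1) - ln (real n))
    - a * ln (real n + 1) - 2 * k * ln (real n)
    - (J * real n powr k + 1) * (ln (J * real n powr k + 1) - k * ln (real n))
    - (1 + a * (J * real n powr k)) * (ln (1 + a * (J * real n powr k)) - k * ln (real n))) / real n powr k)
    \<longlonglongrightarrow> J * (1 + a) - J * ln J - a * J * ln (a * J)"
  using assms by real_asymp

section \<open>Bounds for the row polynomials and their leading term\<close>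

context triangle
begin

definition norm_row :: "nat \<Rightarrow> real \<Rightarrow> real" where
  "norm_row n w = row_sum n w / (\<alpha> ^ n * fact n)"

definition a :: real where "a = \<beta> / \<alpha>"
definition \<kappa> :: real where "\<kappa> = \<beta> / (\<alpha> + \<beta>)"
text \<open>To leading order \<open>J w * n powr \<kappa>\<close> is the index of the largest term
  in the series for \<open>exp (c w) P_n(w)\<close>.\<close>

definition J :: "real \<Rightarrow> real" where "J w = (c * w) powr (1 - \<kappa>) * a powr (- \<kappa>)"

lemma a_pos: "a > 0" and \<kappa>_pos: "\<kappa> > 0" and \<kappa>_less_1: "\<kappa> < 1"
  using pos by (auto simp: a_def \<kappa>_def)

text \<open>This relation balances the powers of \<open>n\<close> in both saddle point
  bounds.\<close>

lemma a_\<kappa>: "a * (1 - \<kappa>) = \<kappa>"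
proof -
  have "1 - \<kappa> = \<alpha> / (\<alpha> + \<beta>)" using pos by (simp add: \<kappa>_def field_simps)
  then show ?thesis using pos by (simp add: a_def \<kappa>_def)
qed

lemma J_pos: "w > 0 \<Longrightarrow> J w > 0"
  using pos a_pos by (simp add: J_def)

lemma row_sum_pos: "w \<ge> 0 \<Longrightarrow> row_sum n w > 0"
proof -
  assume w: "w \<ge> 0"
  have "(\<Sum>k\<in>{0}. T n k * w ^ k) \<le> row_sum n w"
    unfolding row_sum_def using T_nonneg w by (intro sum_mono2) auto
  then show ?thesis using T_0_pos[of n] by simp
qed

lemma norm_row_pos: "w \<ge> 0 \<Longrightarrow> norm_row n w > 0"
  using row_sum_pos[of w n] pos by (simp add: norm_row_def)

lemma prod_eq_rising:
  "(\<Prod>i=1..n. \<alpha> * real i + \<beta> * real j + \<gamma>) = \<alpha> ^ n * fact n * rising n (a * real j + \<gamma> / \<alpha>)"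
proof (induction n)
  case (Suc n)
  have "\<alpha> * real (Suc n) + \<beta> * real j + \<gamma>
    = \<alpha> * real (Suc n) * (1 + (a * real j + \<gamma> / \<alpha>) / real (Suc n))"
    using pos unfolding a_def by (simp add: distrib_left add_divide_distrib del: of_nat_Suc)
  with Suc show ?case by (simp add: rising_def mult_ac)
qed (simp add: rising_def)

lemma norm_row_sums:
  "(\<lambda>j. (c * w) ^ j / fact j * rising n (a * real j + \<gamma> / \<alpha>)) sums (norm_row n w * exp (c * w))"
proof -
  have "(\<lambda>j. (c * w) ^ j / fact j * (\<Prod>i=1..n. \<alpha> * real i + \<beta> * real j + \<gamma>) / (\<alpha> ^ n * fact n))
    sums (row_sum n w * exp (c * w) / (\<alpha> ^ n * fact n))"
    by (intro sums_divide exp_row_sum_sums)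
  then show ?thesis using pos unfolding prod_eq_rising norm_row_def by simp
qed

text \<open>Bounding each coefficient by \<open>rising_le\<close> leaves an exponential series in
  \<open>j\<close>; the factor \<open>exp (c * w)\<close> on the left is at least 1 and is dropped.
  The parameter \<open>\<delta>\<close> stays free for optimization.\<close>

lemma ln_norm_row_le:
  assumes w: "w > 0" and \<delta>: "0 < \<delta>" "\<delta> < 1"
  shows "ln (norm_row n w) \<le> - (real n * ln (1 - \<delta>)) - (\<gamma> / \<alpha> + 1) * ln \<delta> + c * w * \<delta> powr (- a)"
proof -
  define B where "B = \<delta> powr (- (\<gamma> / \<alpha> + 1)) / (1 - \<delta>) ^ n"
  have B: "B > 0" using \<delta> by (simp add: B_def)
  have le: "(c * w) ^ j / fact j * rising n (a * real j + \<gamma> / \<alpha>)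
    \<le> B * ((c * w * \<delta> powr (- a)) ^ j / fact j)" for j
  proof -
    have "rising n (a * real j + \<gamma> / \<alpha>) * (1 - \<delta>) ^ n \<le> \<delta> powr (- (a * real j + \<gamma> / \<alpha> + 1))"
      using a_pos pos \<delta> by (intro rising_le) auto
    also have "\<delta> powr (- (a * real j + \<gamma> / \<alpha> + 1)) = \<delta> powr (- (\<gamma> / \<alpha> + 1)) * (\<delta> powr (- a)) ^ j"
      using \<delta> by (simp add: powr_power powr_add[symmetric] algebra_simps)
    finally have "rising n (a * real j + \<gamma> / \<alpha>) \<le> B * (\<delta> powr (- a)) ^ j"
      using \<delta> by (simp add: B_def field_simps)
    then have "(c * w) ^ j / fact j * rising n (a * real j + \<gamma> / \<alpha>)
      \<le> (c * w) ^ j / fact j * (B * (\<delta> powr (- a)) ^ j)"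
      using pos w by (intro mult_left_mono) auto
    also have "\<dots> = B * ((c * w * \<delta> powr (- a)) ^ j / fact j)"
      by (simp only: power_mult_distrib) simp
    finally show ?thesis .
  qed
  have "(\<lambda>j. (c * w * \<delta> powr (- a)) ^ j / fact j) sums exp (c * w * \<delta> powr (- a))"
    using exp_converges[of "c * w * \<delta> powr (- a)"] by (simp add: field_simps)
  then have "(\<lambda>j. B * ((c * w * \<delta> powr (- a)) ^ j / fact j)) sums (B * exp (c * w * \<delta> powr (- a)))"
    by (rule sums_mult)
  from sums_le[OF le norm_row_sums this]
  have "norm_row n w * exp (c * w) \<le> B * exp (c * w * \<delta> powr (- a))" .
  moreover have "norm_row n w * 1 \<le> norm_row n w * exp (c * w)"
    using norm_row_pos[of w n] pos w by (intro mult_left_mono) auto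
  ultimately have "norm_row n w \<le> B * exp (c * w * \<delta> powr (- a))" by simp
  then have "ln (norm_row n w) \<le> ln (B * exp (c * w * \<delta> powr (- a)))"
    using norm_row_pos[of w n] w B by (subst ln_le_cancel_iff) auto
  also have "\<dots> = ln B + c * w * \<delta> powr (- a)"
    using B by (simp add: ln_mult)
  also have "ln B = - (\<gamma> / \<alpha> + 1) * ln \<delta> - real n * ln (1 - \<delta>)"
    using \<delta> by (simp add: B_def ln_div ln_powr ln_realpow)
  finally show ?thesis by (simp add: algebra_simps)
qed

text \<open>All terms of the series are positive, so a single one, with free index \<open>j\<close>,
  bounds the sum from below; \<open>\<gamma> / \<alpha>\<close> is dropped by monotonicity of
  \<open>rising\<close>.\<close>

lemma ln_norm_row_ge:
  assumes w: "w > 0"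
  shows "ln (norm_row n w) \<ge> real j * ln (c * w) - c * w + real j + a * real j
    + a * real j * ln (real n + 1) - (real j + 1) * ln (real j + 1)
    - (1 + a * real j) * ln (1 + a * real j)"
proof -
  define x where "x = a * real j"
  have x: "x \<ge> 0" using a_pos by (simp add: x_def)
  have cw: "c * w > 0" using pos w by simp
  have "(c * w) ^ j / fact j * rising n x \<le> (c * w) ^ j / fact j * rising n (x + \<gamma> / \<alpha>)"
    using cw x pos by (intro mult_left_mono rising_mono) auto
  also have "\<dots> = (\<Sum>i\<in>{j}. (c * w) ^ i / fact i * rising n (a * real i + \<gamma> / \<alpha>))"
    by (simp add: x_def)
  also have "\<dots> \<le> (\<Sum>i. (c * w) ^ i / fact i * rising n (a * real i + \<gamma> / \<alpha>))"
    using norm_row_sums[of w n] cw a_pos pos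
    by (intro sum_le_suminf mult_nonneg_nonneg less_imp_le[OF rising_pos]) (auto simp: sums_iff)
  also have "\<dots> = norm_row n w * exp (c * w)"
    using norm_row_sums[of w n] by (simp add: sums_iff)
  finally have "ln ((c * w) ^ j / fact j * rising n x) \<le> ln (norm_row n w * exp (c * w))"
    using cw rising_pos[OF x, of n] norm_row_pos[of w n] w by (subst ln_le_cancel_iff) auto
  moreover have "ln (norm_row n w * exp (c * w)) = ln (norm_row n w) + c * w"
    using norm_row_pos[of w n] w by (simp add: ln_mult)
  moreover have "ln ((c * w) ^ j / fact j * rising n x)
    = real j * ln (c * w) - ln (fact j) + ln (rising n x)"
    using pos w rising_pos[OF x, of n] by (simp add: ln_mult ln_div ln_realpow del: times_divide_eq_left)
  ultimately show ?thesis
    using ln_rising_ge_simple[OF x, of n] ln_fact_le[of j] by (simp add: x_def)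
qed

text \<open>Saddle point: the radius \<open>1 - \<delta>\<close> with \<open>\<delta> = a * J w * n powr (\<kappa> - 1)\<close> optimizes the upper bound and
  the index \<open>j\<close> near \<open>J w * n powr \<kappa>\<close> the lower bound; both give the same leading term.\<close>

lemma ln_norm_row_limit:
  assumes w: "w > 0"
  shows "(\<lambda>n. ln (norm_row n w) / real n powr \<kappa>) \<longlonglongrightarrow> J w * (1 + a)"
proof (rule tendsto_sandwich)
  define d where "d = a * J w"
  have d: "d > 0" using a_pos J_pos[OF w] by (simp add: d_def)
  have cw: "c * w > 0" using pos w by simp
  have ln_J: "ln (J w) = (1 - \<kappa>) * ln (c * w) - \<kappa> * ln a"
    using pos w a_pos by (simp add: J_def ln_mult ln_powr)
  \<comment> \<open>The saddle point equation in logarithmic form.\<close>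
  have ln_cw: "ln (c * w) = (1 + a) * ln (J w) + a * ln a"
  proof -
    have "(1 + a) * (1 - \<kappa>) = 1" using a_\<kappa> by (simp add: algebra_simps)
    moreover have "(1 + a) * \<kappa> = a" using a_\<kappa> by (simp add: algebra_simps)
    moreover have "(1 + a) * ln (J w) = ((1 + a) * (1 - \<kappa>)) * ln (c * w) - ((1 + a) * \<kappa>) * ln a"
      unfolding ln_J by (simp add: algebra_simps)
    ultimately show ?thesis by simp
  qed
  \<comment> \<open>By this identity the last summand of the upper bound becomes
    \<open>J w * n powr \<kappa>\<close>.\<close>
  have cwd: "c * w * d powr (- a) = J w"
  proof -
    have "ln (c * w * d powr (- a)) = ln (c * w) + ln (d powr (- a))"
      using cw d by (intro ln_mult_pos) auto
    also have "ln (d powr (- a)) = - a * (ln a + ln (J w))"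
      using a_pos J_pos[OF w] by (simp add: d_def ln_mult ln_powr)
    finally have "ln (c * w * d powr (- a)) = ln (J w)"
      unfolding ln_cw by (simp add: algebra_simps)
    moreover have "c * w * d powr (- a) > 0" using d by (intro mult_pos_pos cw) simp
    ultimately show ?thesis using ln_inj_iff J_pos[OF w] by blast
  qed

  let ?\<delta> = "\<lambda>n::nat. d * real n powr (\<kappa> - 1)"
  let ?U = "\<lambda>n::nat. - (real n * ln (1 - ?\<delta> n)) / real n powr \<kappa>
    - (\<gamma> / \<alpha> + 1) * (ln (?\<delta> n) / real n powr \<kappa>) + J w"
  show "eventually (\<lambda>n. ln (norm_row n w) / real n powr \<kappa> \<le> ?U n) sequentially"
  proof -
    have "eventually (\<lambda>n. ?\<delta> n < 1) sequentially"
      using \<kappa>_less_1 d by real_asymp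
    then show ?thesis using eventually_gt_at_top[of 0]
    proof eventually_elim
      case (elim n)
      have N: "real n powr \<kappa> > 0" using elim by simp
      have "?\<delta> n > 0" using d elim by simp
      from ln_norm_row_le[OF w this elim(1), of n]
      have "ln (norm_row n w) \<le> - (real n * ln (1 - ?\<delta> n)) - (\<gamma> / \<alpha> + 1) * ln (?\<delta> n)
        + c * w * ?\<delta> n powr (- a)" .
      also have "c * w * ?\<delta> n powr (- a) = (c * w * d powr (- a)) * real n powr (a * (1 - \<kappa>))"
        using d elim by (simp add: powr_mult powr_powr algebra_simps)
      also have "\<dots> = J w * real n powr \<kappa>"
        unfolding cwd a_\<kappa> ..
      finally show ?case using N by (simp add: field_simps)
    qed
  qed
  have "?U \<longlonglongrightarrow> d - (\<gamma> / \<alpha> + 1) * 0 + J w"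
    using \<kappa>_pos \<kappa>_less_1 d by (intro tendsto_add tendsto_diff tendsto_mult tendsto_const saddle_limit_linear saddle_limit_ln)
  then have U_lim: "?U \<longlonglongrightarrow> J w * (1 + a)"
    by (simp add: d_def algebra_simps)

  define j where "j n = nat \<lfloor>J w * real n powr \<kappa>\<rfloor>" for n :: nat
  have j: "J w * real n powr \<kappa> - 1 \<le> real (j n)" "real (j n) \<le> J w * real n powr \<kappa>" for n
    unfolding j_def using J_pos[OF w] by (simp_all add: of_nat_nat)
  let ?y = "\<lambda>n::nat. J w * real n powr \<kappa>"
  let ?V = "\<lambda>n::nat. (?y n * (1 + a) - (1 + a) + ?y n * a * (ln (real n + 1) - ln (real n))
    - a * ln (real n + 1) - 2 * \<kappa> * ln (real n)
    - (?y n + 1) * (ln (?y n + 1) - \<kappa> * ln (real n))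
    - (1 + a * (?y n)) * (ln (1 + a * (?y n)) - \<kappa> * ln (real n))) / real n powr \<kappa>"
  let ?L = "\<lambda>n::nat. real (j n) / real n powr \<kappa> * ln (c * w) - c * w / real n powr \<kappa> + ?V n"
  show "eventually (\<lambda>n. ?L n \<le> ln (norm_row n w) / real n powr \<kappa>) sequentially"
    using eventually_gt_at_top[of 0]
  proof eventually_elim
    case (elim n)
    define y where "y = ?y n"
    have N: "real n powr \<kappa> > 0" using elim by simp
    have y: "y - 1 \<le> real (j n)" "real (j n) \<le> y"
      using j[of n] by (auto simp: y_def)
    have split: "(p * x - q + V * N) / N = p / N * x - q / N + V" if "N > 0" for p x q V N :: real
      using that by (simp add: field_simps)
    define l where "l = ln (real n)"
    define l1 where "l1 = ln (real n + 1)"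
    have l1: "l1 \<ge> 0" by (simp add: l1_def)
    \<comment> \<open>The index \<open>j n\<close> is replaced by \<open>y\<close> or
      \<open>y - 1\<close> where monotonicity allows; the term with \<open>ln (c * w)\<close>, which
      may have either sign, keeps \<open>j n\<close>.\<close>
    have "(y - 1) * (1 + a + a * l1) \<le> real (j n) * (1 + a + a * l1)"
      using y a_pos l1 by (intro mult_right_mono) auto
    moreover have "(real (j n) + 1) * ln (real (j n) + 1) \<le> (y + 1) * ln (y + 1)"
      using y by (intro mult_mono ln_mono) auto
    moreover have "(1 + a * real (j n)) * ln (1 + a * real (j n)) \<le> (1 + a * y) * ln (1 + a * y)"
      using y a_pos by (intro mult_mono ln_mono add_left_mono mult_left_mono) (auto intro!: add_pos_nonneg)
    ultimately have "real (j n) * ln (c * w) - c * w + (y - 1) * (1 + a + a * l1)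
      - (y + 1) * ln (y + 1) - (1 + a * y) * ln (1 + a * y) \<le> ln (norm_row n w)"
      using ln_norm_row_ge[OF w, where j = "j n" and n = n] by (simp add: l1_def algebra_simps)
    \<comment> \<open>Inserting multiples of \<open>l\<close> makes the logarithms convergent. The
      summand \<open>- 2 * \<kappa> * l\<close> comes from the constants in \<open>y + 1\<close> and
      \<open>1 + a * y\<close>; the last term vanishes by \<open>a_\<kappa>\<close>.\<close>
    moreover have "(y - 1) * (1 + a + a * l1) - (y + 1) * ln (y + 1) - (1 + a * y) * ln (1 + a * y)
      = y * (1 + a) - (1 + a) + y * a * (l1 - l) - a * l1 - 2 * \<kappa> * l
        - (y + 1) * (ln (y + 1) - \<kappa> * l) - (1 + a * y) * (ln (1 + a * y) - \<kappa> * l)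
        + y * l * (a * (1 - \<kappa>) - \<kappa>)"
      by (simp add: algebra_simps)
    ultimately have "real (j n) * ln (c * w) - c * w + ?V n * real n powr \<kappa> \<le> ln (norm_row n w)"
      using N by (simp add: a_\<kappa> y_def l_def l1_def)
    from divide_right_mono[OF this, of "real n powr \<kappa>"]
    show ?case unfolding split[OF N] by simp
  qed
  have "(\<lambda>n. real (j n) / real n powr \<kappa>) \<longlonglongrightarrow> J w"
  proof (rule tendsto_sandwich)
    show "eventually (\<lambda>n. (J w * real n powr \<kappa> - 1) / real n powr \<kappa> \<le> real (j n) / real n powr \<kappa>) sequentially"
      using j by (intro always_eventually allI divide_right_mono) auto
    show "eventually (\<lambda>n. real (j n) / real n powr \<kappa> \<le> J w * real n powr \<kappa> / real n powr \<kappa>) sequentially"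
      using j by (intro always_eventually allI divide_right_mono) auto
    show "(\<lambda>n::nat. (J w * real n powr \<kappa> - 1) / real n powr \<kappa>) \<longlonglongrightarrow> J w"
      using \<kappa>_pos by real_asymp
    show "(\<lambda>n::nat. J w * real n powr \<kappa> / real n powr \<kappa>) \<longlonglongrightarrow> J w"
      using \<kappa>_pos by real_asymp
  qed
  moreover have "(\<lambda>n::nat. c * w / real n powr \<kappa>) \<longlonglongrightarrow> 0"
    using \<kappa>_pos by real_asymp
  ultimately have "?L \<longlonglongrightarrow> J w * ln (c * w) - 0
      + (J w * (1 + a) - J w * ln (J w) - a * J w * ln (a * J w))"
    using saddle_limit_index[OF \<kappa>_pos \<kappa>_less_1 J_pos[OF w] a_pos] by (intro tendsto_intros)
  \<comment> \<open>The saddle point equation cancels all logarithms, so the lower limit matches the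
    upper one.\<close>
  also have "J w * ln (c * w) - 0 + (J w * (1 + a) - J w * ln (J w) - a * J w * ln (a * J w)) = J w * (1 + a)"
    unfolding ln_cw using a_pos J_pos[OF w] by (simp add: ln_mult algebra_simps)
  finally show "?L \<longlonglongrightarrow> J w * (1 + a)" .
  show "?U \<longlonglongrightarrow> J w * (1 + a)" by (rule U_lim)
qed

section \<open>Logarithmic derivatives of the row polynomials\<close>

lemma ln_norm_row_eq:
  assumes "w > 0"
  shows "ln (norm_row n w) = ln (T n n / (\<alpha> ^ n * fact n)) + (\<Sum>i<n. ln (w + neg_root n i))"
proof -
  have "(\<Prod>i<n. w + neg_root n i) > 0"
    using neg_root_pos assms by (intro prod_pos) (auto intro: add_pos_pos)
  moreover have "ln (\<Prod>i<n. w + neg_root n i) = (\<Sum>i<n. ln (w + neg_root n i))"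
    using neg_root_pos assms by (intro ln_prod) (auto intro!: add_pos_pos simp: add_pos_pos less_imp_neq[symmetric])
  moreover have "norm_row n w = T n n / (\<alpha> ^ n * fact n) * (\<Prod>i<n. w + neg_root n i)"
    by (simp add: norm_row_def row_sum_factor)
  moreover have "T n n / (\<alpha> ^ n * fact n) > 0"
    using T_diag_pos pos by simp
  ultimately show ?thesis by (simp only: ln_mult_pos)
qed

lemma J_eq: "w > 0 \<Longrightarrow> J w = J 1 * w powr (1 - \<kappa>)"
  using pos by (simp add: J_def powr_mult[symmetric])

text \<open>By the factorization \<open>ln (norm_row n w)\<close> is a constant plus a sum of
  concave functions \<open>ln (w + r)\<close>, so its limit may be differentiated in
  \<open>w\<close>.\<close>

lemma log_derivative_limit:
  assumes w: "w > 0"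
  shows "(\<lambda>n. (\<Sum>i<n. 1 / (w + neg_root n i)) / real n powr \<kappa>) \<longlonglongrightarrow> J 1 * w powr (- \<kappa>)"
proof (rule tendsto_supergradient)
  show "(\<lambda>n. ln (norm_row n y) / real n powr \<kappa>) \<longlonglongrightarrow> J 1 * y powr (1 - \<kappa>) * (1 + a)" if "y > 0" for y
    using ln_norm_row_limit[OF that] unfolding J_eq[OF that] .
  show "ln (norm_row n y) / real n powr \<kappa> \<le> ln (norm_row n w) / real n powr \<kappa>
      + (\<Sum>i<n. 1 / (w + neg_root n i)) / real n powr \<kappa> * (y - w)" if y: "y > 0" for n y
  proof -
    have "ln (y + neg_root n i) - ln (w + neg_root n i) \<le> 1 / (w + neg_root n i) * (y - w)" if i: "i < n" for i
    proof -
      have p: "y + neg_root n i > 0" "w + neg_root n i > 0" using neg_root_pos[OF i] y w by auto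
      then have "ln (y + neg_root n i) - ln (w + neg_root n i) = ln ((y + neg_root n i) / (w + neg_root n i))"
        by (simp add: ln_div)
      also have "\<dots> \<le> (y + neg_root n i) / (w + neg_root n i) - 1"
        using p by (intro ln_le_minus_one) auto
      also have "\<dots> = 1 / (w + neg_root n i) * (y - w)" using p by (simp add: field_simps)
      finally show ?thesis .
    qed
    then have "(\<Sum>i<n. ln (y + neg_root n i) - ln (w + neg_root n i)) \<le> (\<Sum>i<n. 1 / (w + neg_root n i) * (y - w))"
      by (intro sum_mono) auto
    then have "ln (norm_row n y) \<le> ln (norm_row n w) + (\<Sum>i<n. 1 / (w + neg_root n i)) * (y - w)"
      unfolding ln_norm_row_eq[OF y] ln_norm_row_eq[OF w] by (simp add: sum_subtractf sum_distrib_right)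
    then have "ln (norm_row n y) / real n powr \<kappa>
      \<le> (ln (norm_row n w) + (\<Sum>i<n. 1 / (w + neg_root n i)) * (y - w)) / real n powr \<kappa>"
      by (rule divide_right_mono) simp
    then show ?thesis by (simp add: add_divide_distrib)
  qed
  have "((\<lambda>y. J 1 * y powr (1 - \<kappa>) * (1 + a)) has_real_derivative
      (J 1 * ((1 - \<kappa>) * w powr (1 - \<kappa> - 1)) * (1 + a))) (at w)"
    using w by (auto intro!: derivative_eq_intros)
  also have "J 1 * ((1 - \<kappa>) * w powr (1 - \<kappa> - 1)) * (1 + a) = J 1 * w powr (- \<kappa>) * ((1 - \<kappa>) * (1 + a))"
    by (simp add: mult_ac)
  also have "(1 - \<kappa>) * (1 + a) = 1" using a_\<kappa> by (simp add: algebra_simps)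
  finally show "((\<lambda>y. J 1 * y powr (1 - \<kappa>) * (1 + a)) has_real_derivative J 1 * w powr (- \<kappa>)) (at w)"
    by simp
qed (use w in auto)

lemma sum_inverse_limit:
  "(\<lambda>n. (\<Sum>i<n. 1 / (1 + neg_root n i)) / real n powr \<kappa>) \<longlonglongrightarrow> J 1"
  using log_derivative_limit[of 1] by simp

text \<open>Second differentiation: \<open>w / (w + r)\<close> is concave in \<open>w\<close> with
  derivative \<open>r / (1 + r)^2\<close> at 1, the variance of a Bernoulli variable with parameter
  \<open>1 / (1 + r)\<close>.\<close>

lemma sum_variance_limit:
  "(\<lambda>n. (\<Sum>i<n. neg_root n i / (1 + neg_root n i)\<^sup>2) / real n powr \<kappa>) \<longlonglongrightarrow> J 1 * (1 - \<kappa>)"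
proof (rule tendsto_supergradient[where x = 1])
  show "(\<lambda>n. (\<Sum>i<n. y / (y + neg_root n i)) / real n powr \<kappa>) \<longlonglongrightarrow> J 1 * y powr (1 - \<kappa>)" if "y > 0" for y
  proof -
    have "(\<lambda>n. y * ((\<Sum>i<n. 1 / (y + neg_root n i)) / real n powr \<kappa>)) \<longlonglongrightarrow> y * (J 1 * y powr (- \<kappa>))"
      by (intro tendsto_mult tendsto_const log_derivative_limit that)
    moreover have "y * (J 1 * y powr (- \<kappa>)) = J 1 * y powr (1 - \<kappa>)"
      using that by (simp add: powr_diff powr_minus field_simps)
    ultimately show ?thesis by (simp add: sum_distrib_left)
  qed
  show "(\<Sum>i<n. y / (y + neg_root n i)) / real n powr \<kappa> \<le> (\<Sum>i<n. 1 / (1 + neg_root n i)) / real n powr \<kappa>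
    + (\<Sum>i<n. neg_root n i / (1 + neg_root n i)\<^sup>2) / real n powr \<kappa> * (y - 1)" if y: "y > 0" for n y
  proof -
    have "y / (y + neg_root n i) - 1 / (1 + neg_root n i) \<le> neg_root n i / (1 + neg_root n i)\<^sup>2 * (y - 1)" if i: "i < n" for i
    proof -
      define r where "r = neg_root n i"
      have r: "r > 0" using neg_root_pos[OF i] by (simp add: r_def)
      \<comment> \<open>The gap between the tangent at 1 and the function is a square times a
        positive factor.\<close>
      have "r / (1 + r)\<^sup>2 * (y - 1) - (y / (y + r) - 1 / (1 + r)) = r * (y - 1)\<^sup>2 / ((1 + r)\<^sup>2 * (y + r))"
        using r y by (simp add: divide_simps) (simp add: algebra_simps power2_eq_square)
      also have "\<dots> \<ge> 0" using r y by simp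
      finally show ?thesis by (simp add: r_def)
    qed
    then have "(\<Sum>i<n. y / (y + neg_root n i) - 1 / (1 + neg_root n i)) \<le> (\<Sum>i<n. neg_root n i / (1 + neg_root n i)\<^sup>2 * (y - 1))"
      by (intro sum_mono) auto
    then have "(\<Sum>i<n. y / (y + neg_root n i)) \<le> (\<Sum>i<n. 1 / (1 + neg_root n i)) + (\<Sum>i<n. neg_root n i / (1 + neg_root n i)\<^sup>2) * (y - 1)"
      by (simp add: sum_subtractf sum_distrib_right)
    then have "(\<Sum>i<n. y / (y + neg_root n i)) / real n powr \<kappa>
      \<le> ((\<Sum>i<n. 1 / (1 + neg_root n i)) + (\<Sum>i<n. neg_root n i / (1 + neg_root n i)\<^sup>2) * (y - 1)) / real n powr \<kappa>"
      by (rule divide_right_mono) simp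
    then show ?thesis by (simp add: add_divide_distrib)
  qed
  show "((\<lambda>y. J 1 * y powr (1 - \<kappa>)) has_real_derivative J 1 * (1 - \<kappa>)) (at 1)"
    by (auto intro!: derivative_eq_intros)
qed simp

end

section \<open>Sums of Bernoulli variables\<close>

text \<open>With \<open>L = P' / P\<close> this is \<open>P'' / P = L^2 + L'\<close>, since
  \<open>L'\<close> is minus the sum of the inverse squares.\<close>

lemma poly_pderiv2_prod_linear:
  fixes z :: "'a :: field_char_0" and n :: nat
  assumes "\<And>i. i < n \<Longrightarrow> z + r i \<noteq> 0"
  shows "poly (pderiv (pderiv (\<Prod>i<n. [:r i, 1:]))) z
    = poly (\<Prod>i<n. [:r i, 1:]) z * ((\<Sum>i<n. 1 / (z + r i))\<^sup>2 - (\<Sum>i<n. 1 / (z + r i)\<^sup>2))"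
  using assms
proof (induction n)
  case (Suc n)
  define Q where "Q = (\<Prod>i<n. [:r i, 1:])"
  define x where "x = z + r n"
  define S where "S = (\<Sum>i<n. 1 / (z + r i))"
  define S2 where "S2 = (\<Sum>i<n. 1 / (z + r i)\<^sup>2)"
  have x: "x \<noteq> 0" using Suc.prems[of n] by (simp add: x_def)
  have 1: "poly (pderiv Q) z = poly Q z * S"
    unfolding Q_def S_def using Suc.prems by (intro poly_pderiv_prod_linear) auto
  have 2: "poly (pderiv (pderiv Q)) z = poly Q z * (S\<^sup>2 - S2)"
    unfolding Q_def S_def S2_def using Suc by simp
  \<comment> \<open>The second derivative of a linear factor vanishes, so two terms of the Leibniz
    rule remain.\<close>
  have "pderiv (pderiv (Q * L)) = pderiv (pderiv Q) * L + 2 * pderiv Q" if "pderiv L = 1" for L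
    using that by (simp add: pderiv_mult pderiv_add algebra_simps)
  from this[of "[:r n, 1:]"]
  have "pderiv (pderiv (Q * [:r n, 1:])) = pderiv (pderiv Q) * [:r n, 1:] + 2 * pderiv Q"
    by (simp add: pderiv_pCons del: mult_pCons_right)
  then have "poly (pderiv (pderiv (Q * [:r n, 1:]))) z = poly Q z * (S\<^sup>2 - S2) * x + 2 * (poly Q z * S)"
    by (simp add: 1 2 x_def add.commute del: mult_pCons_right)
  also have "\<dots> = poly Q z * x * ((S + 1 / x)\<^sup>2 - (S2 + 1 / x\<^sup>2))"
    using x by (simp add: power2_eq_square divide_simps) (simp add: algebra_simps)
  finally show ?case
    by (simp add: Q_def[symmetric] S_def[symmetric] S2_def[symmetric] x_def[symmetric] add.commute[of _ "r n"] del: mult_pCons_right)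
      (simp add: x_def add.commute)
qed simp

text \<open>The probabilities at \<open>0..n\<close> sum to 1, so \<open>X\<close> lies there almost
  surely and \<open>f (X \<omega>)\<close> is a finite combination of indicators. The codomain
  \<open>'b\<close> covers real moments and the complex characteristic function.\<close>

lemma (in prob_space) integral_finitely_supported:
  fixes f :: "int \<Rightarrow> 'b :: {banach, second_countable_topology}"
  assumes X: "X \<in> measurable M (count_space UNIV)"
    and q: "\<And>k. k \<le> n \<Longrightarrow> prob {\<omega> \<in> space M. X \<omega> = int k} = q k"
    and sum: "(\<Sum>k\<le>n. q k) = 1"
  shows "expectation (\<lambda>\<omega>. f (X \<omega>)) = (\<Sum>k\<le>n. q k *\<^sub>R f (int k))"
    and "integrable M (\<lambda>\<omega>. f (X \<omega>))"
proof -
  define A where "A k = {\<omega> \<in> space M. X \<omega> = int k}" for k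
  have A: "A k \<in> events" for k
  proof -
    have "A k = X -` {int k} \<inter> space M" by (auto simp: A_def)
    then show ?thesis using measurable_sets[OF X, of "{int k}"] by simp
  qed
  have "prob (\<Union>k\<in>{..n}. A k) = (\<Sum>k\<le>n. prob (A k))"
    using A by (intro finite_measure_finite_Union) (auto simp: disjoint_family_on_def A_def)
  also have "\<dots> = 1" using q sum by (simp add: A_def)
  finally have "AE \<omega> in M. \<omega> \<in> (\<Union>k\<in>{..n}. A k)"
    using A by (intro prob_eq_1[THEN iffD1]) auto
  then have ae: "AE \<omega> in M. f (X \<omega>) = (\<Sum>k\<le>n. indicator (A k) \<omega> *\<^sub>R f (int k))"
  proof eventually_elim
    case (elim \<omega>)
    then obtain k where k: "k \<le> n" "\<omega> \<in> A k" by auto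
    have "(\<Sum>i\<le>n. indicator (A i) \<omega> *\<^sub>R f (int i)) = (\<Sum>i\<le>n. if i = k then f (X \<omega>) else 0)"
      using k by (intro sum.cong) (auto simp: A_def indicator_def)
    then show ?case using k by simp
  qed
  have int: "integrable M (\<lambda>\<omega>. indicator (A k) \<omega> *\<^sub>R f (int k))" for k
    using A by (intro integrable_scaleR_left integrable_real_indicator) (auto simp: less_top[symmetric])
  have meas: "(\<lambda>\<omega>. f (X \<omega>)) \<in> borel_measurable M"
    using X by measurable
  have "expectation (\<lambda>\<omega>. f (X \<omega>)) = expectation (\<lambda>\<omega>. \<Sum>k\<le>n. indicator (A k) \<omega> *\<^sub>R f (int k))"
    using ae meas int by (intro integral_cong_AE borel_measurable_sum borel_measurable_integrable[OF int])
  also have "\<dots> = (\<Sum>k\<le>n. prob (A k) *\<^sub>R f (int k))"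
    using int A by (subst Bochner_Integration.integral_sum) (auto simp: less_top[symmetric])
  also have "\<dots> = (\<Sum>k\<le>n. q k *\<^sub>R f (int k))"
    using q by (intro sum.cong) (auto simp: A_def)
  finally show "expectation (\<lambda>\<omega>. f (X \<omega>)) = (\<Sum>k\<le>n. q k *\<^sub>R f (int k))" .
  show "integrable M (\<lambda>\<omega>. f (X \<omega>))"
  proof (rule integrable_cong_AE_imp)
    show "integrable M (\<lambda>\<omega>. \<Sum>k\<le>n. indicator (A k) \<omega> *\<^sub>R f (int k))"
      using int by (rule Bochner_Integration.integrable_sum)
    show "AE \<omega> in M. (\<Sum>k\<le>n. indicator (A k) \<omega> *\<^sub>R f (int k)) = f (X \<omega>)"
      using ae by eventually_elim (rule sym)
  qed (rule meas)
qed

section \<open>Estimates for Bernoulli characteristic functions\<close>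

lemma abs_exp_minus_linear_le:
  fixes x :: real assumes "x \<ge> 0" shows "\<bar>exp (- x) - (1 - x)\<bar> \<le> x\<^sup>2 / 2"
proof -
  define g where "g t = 1 - t + t\<^sup>2 / 2 - exp (- t)" for t :: real
  have "g 0 \<le> g x"
  proof (rule DERIV_nonneg_imp_nondecreasing[OF assms])
    fix t :: real
    have "(g has_real_derivative (t - 1 + exp (- t))) (at t)"
      unfolding g_def by (auto intro!: derivative_eq_intros)
    moreover have "t - 1 + exp (- t) \<ge> 0" using exp_ge_add_one_self[of "- t"] by simp
    ultimately show "\<exists>y. (g has_real_derivative y) (at t) \<and> y \<ge> 0" by blast
  qed
  then show ?thesis using exp_ge_add_one_self[of "- x"] by (simp add: g_def)
qed

text \<open>The centred variable takes the values \<open>- p\<close> and \<open>1 - p\<close>. In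
  the second order Taylor expansion the linear terms cancel and the quadratic ones give the
  variance; the cubic remainders add up to the third absolute moment, which is at most
  \<open>p * (1 - p)\<close>.\<close>

lemma centred_bernoulli_char:
  fixes p u :: real
  assumes p: "0 \<le> p" "p \<le> 1"
  shows "cmod (iexp (- (u * p)) * (1 - p + p * iexp u) - of_real (1 - u\<^sup>2 * (p * (1 - p)) / 2))
    \<le> \<bar>u\<bar> ^ 3 * (p * (1 - p))"
proof -
  define R where "R x = iexp x - (1 + \<i> * x - x\<^sup>2 / 2)" for x :: real
  have R: "cmod (R x) \<le> \<bar>x\<bar> ^ 3" for x
  proof -
    have "cmod (R x) \<le> \<bar>x\<bar> ^ 3 / fact 3"
      using iexp_approx1[of x 2] by (simp add: R_def numeral_eq_Suc power_mult_distrib algebra_simps)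
    also have "\<dots> \<le> \<bar>x\<bar> ^ 3 / 1"
      by (intro divide_left_mono) (auto simp: fact_numeral)
    finally show ?thesis by simp
  qed
  have "iexp (- (u * p)) * iexp u = iexp (u * (1 - p))"
    by (simp add: exp_add[symmetric] algebra_simps)
  then have "iexp (- (u * p)) * (1 - p + p * iexp u) = (1 - p) * iexp (- (u * p)) + p * iexp (u * (1 - p))"
    by (simp add: algebra_simps)
  also have "\<dots> - of_real (1 - u\<^sup>2 * (p * (1 - p)) / 2)
    = of_real (1 - p) * R (- (u * p)) + of_real p * R (u * (1 - p))"
    by (simp add: R_def field_simps power2_eq_square)
  finally have "cmod (iexp (- (u * p)) * (1 - p + p * iexp u) - of_real (1 - u\<^sup>2 * (p * (1 - p)) / 2))
    \<le> cmod (of_real (1 - p) * R (- (u * p))) + cmod (of_real p * R (u * (1 - p)))"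
    using norm_triangle_ineq by metis
  also have "\<dots> \<le> (1 - p) * \<bar>u * p\<bar> ^ 3 + p * \<bar>u * (1 - p)\<bar> ^ 3"
    using p R[of "- (u * p)"] R[of "u * (1 - p)"] unfolding norm_mult norm_of_real by (intro add_mono mult_mono) auto
  also have "\<dots> = \<bar>u\<bar> ^ 3 * (p * (1 - p)) * (p\<^sup>2 + (1 - p)\<^sup>2)"
  proof -
    have "\<bar>u * p\<bar> = \<bar>u\<bar> * p" "\<bar>u * (1 - p)\<bar> = \<bar>u\<bar> * (1 - p)"
      using p by (simp_all add: abs_mult)
    then show ?thesis by (simp only:) (simp add: power2_eq_square power3_eq_cube algebra_simps)
  qed
  also have "\<dots> \<le> \<bar>u\<bar> ^ 3 * (p * (1 - p)) * 1"
  proof (intro mult_left_mono)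
    have "p\<^sup>2 + (1 - p)\<^sup>2 = 1 - 2 * (p * (1 - p))" by (simp add: power2_eq_square algebra_simps)
    then show "p\<^sup>2 + (1 - p)\<^sup>2 \<le> 1" using p by simp
  qed (use p in simp)
  finally show ?thesis by simp
qed

lemma bernoulli_char_le_1:
  fixes p u :: real
  assumes p: "0 \<le> p" "p \<le> 1"
  shows "cmod (iexp (- (u * p)) * (1 - p + p * iexp u)) \<le> 1"
proof -
  have "cmod (iexp (- (u * p)) * (1 - p + p * iexp u)) = cmod (of_real (1 - p) + of_real p * iexp u)"
    by (simp add: norm_mult)
  also have "\<dots> \<le> cmod (of_real (1 - p)) + cmod (of_real p * iexp u)"
    by (rule norm_triangle_ineq)
  also have "\<dots> = 1" using p by (simp add: norm_mult del: of_real_diff)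
  finally show ?thesis .
qed

text \<open>Lyapunov's condition is automatic for sums of Bernoulli variables: the third absolute
  moments are bounded by the variances.\<close>

lemma bernoulli_sum_char_limit:
  fixes p :: "nat \<Rightarrow> nat \<Rightarrow> real" and s :: "nat \<Rightarrow> real"
  assumes p: "\<And>n i. i < n \<Longrightarrow> 0 \<le> p n i \<and> p n i \<le> 1"
    and s: "\<And>n. (s n)\<^sup>2 = (\<Sum>i<n. p n i * (1 - p n i))" "\<And>n. s n \<ge> 0"
    and lim: "filterlim s at_top sequentially"
  shows "(\<lambda>n. \<Prod>i<n. iexp (- (t / s n * p n i)) * (1 - p n i + p n i * iexp (t / s n)))
    \<longlonglongrightarrow> complex_of_real (exp (- t\<^sup>2 / 2))"
proof -
  define v where "v n i = p n i * (1 - p n i)" for n i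
  have v: "0 \<le> v n i" "v n i \<le> 1" if "i < n" for n i
    using p[OF that] mult_le_one[of "p n i" "1 - p n i"] by (auto simp: v_def)
  have "eventually (\<lambda>n. cmod ((\<Prod>i<n. iexp (- (t / s n * p n i)) * (1 - p n i + p n i * iexp (t / s n)))
      - of_real (exp (- t\<^sup>2 / 2))) \<le> \<bar>t\<bar> ^ 3 / s n + t ^ 4 / (s n)\<^sup>2) sequentially"
    using filterlim_at_top_dense[THEN iffD1, OF lim, rule_format, of 0]
  proof eventually_elim
    case (elim n)
    define u where "u = t / s n"
    define z where "z i = iexp (- (u * p n i)) * (1 - p n i + p n i * iexp u)" for i
    \<comment> \<open>\<open>y i\<close> is the Gaussian factor with the same variance; the product
      of all of them is exactly the limit.\<close>
    define y where "y i = complex_of_real (exp (- (u\<^sup>2 * v n i / 2)))" for i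
    have sv: "(\<Sum>i<n. v n i) = (s n)\<^sup>2" by (simp add: v_def s)
    have "(\<Prod>i<n. y i) = of_real (exp (\<Sum>i<n. - (u\<^sup>2 * v n i / 2)))"
      unfolding y_def by (simp add: exp_sum)
    also have "(\<Sum>i<n. - (u\<^sup>2 * v n i / 2)) = - (u\<^sup>2 * (\<Sum>i<n. v n i) / 2)"
      by (simp add: sum_negf sum_distrib_left sum_divide_distrib)
    also have "\<dots> = - t\<^sup>2 / 2"
      using elim unfolding sv u_def by (simp add: power_divide)
    finally have y: "(\<Prod>i<n. y i) = of_real (exp (- t\<^sup>2 / 2))" .
    have zy: "cmod (z i - y i) \<le> (\<bar>u\<bar> ^ 3 + u ^ 4) * v n i" if i: "i < n" for i
    proof -
      define x where "x = u\<^sup>2 * v n i / 2"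
      have x: "x \<ge> 0" using v[OF i] by (simp add: x_def)
      have "cmod (z i - of_real (1 - x)) \<le> \<bar>u\<bar> ^ 3 * v n i"
        unfolding z_def x_def v_def using p[OF i] by (intro centred_bernoulli_char) auto
      moreover have "cmod (of_real (1 - x) - y i) \<le> x\<^sup>2 / 2"
        unfolding y_def x_def[symmetric] of_real_diff[symmetric] norm_of_real
        using abs_exp_minus_linear_le[OF x] by (simp add: abs_minus_commute)
      \<comment> \<open>As \<open>v n i \<le> 1\<close>, its square is at most \<open>v n i\<close>,
        whose sum is known.\<close>
      moreover have "x\<^sup>2 / 2 \<le> u ^ 4 * v n i"
      proof -
        have "x\<^sup>2 / 2 = u ^ 4 * (v n i * v n i) / 8"
          by (simp add: x_def power2_eq_square numeral_eq_Suc)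
        also have "\<dots> \<le> u ^ 4 * (v n i * 1) / 1"
          using v[OF i] by (intro frac_le mult_left_mono) auto
        finally show ?thesis by simp
      qed
      moreover have "cmod (z i - y i) \<le> cmod (z i - of_real (1 - x)) + cmod (of_real (1 - x) - y i)"
        by (metis norm_triangle_ineq diff_add_cancel add_diff_eq)
      ultimately show ?thesis by (simp add: algebra_simps)
    qed
    \<comment> \<open>For factors in the unit disc, the distance of the products is at most the sum
      of the distances.\<close>
    have "cmod ((\<Prod>i<n. z i) - (\<Prod>i<n. y i)) \<le> (\<Sum>i<n. cmod (z i - y i))"
    proof (rule norm_prod_diff)
      show "cmod (z i) \<le> 1" if "i \<in> {..<n}" for i
        unfolding z_def using p[of i n] that by (intro bernoulli_char_le_1) auto
      show "cmod (y i) \<le> 1" if "i \<in> {..<n}" for i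
        using v[of i n] that by (simp add: y_def)
    qed
    also have "\<dots> \<le> (\<Sum>i<n. (\<bar>u\<bar> ^ 3 + u ^ 4) * v n i)"
      using zy by (intro sum_mono) auto
    also have "\<dots> = (\<bar>u\<bar> ^ 3 + u ^ 4) * (s n)\<^sup>2"
      by (simp add: sum_distrib_left[symmetric] sv)
    also have "\<dots> = \<bar>t\<bar> ^ 3 / s n + t ^ 4 / (s n)\<^sup>2"
      using elim by (simp add: u_def field_simps power_divide abs_divide numeral_eq_Suc)
    finally show ?case unfolding y z_def u_def .
  qed
  moreover have "(\<lambda>n. \<bar>t\<bar> ^ 3 / s n + t ^ 4 / (s n)\<^sup>2) \<longlonglongrightarrow> 0"
  proof -
    have "filterlim s at_infinity sequentially"
      using lim by (rule filterlim_at_top_imp_at_infinity)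
    then have "(\<lambda>n. inverse (s n)) \<longlonglongrightarrow> 0"
      by (rule filterlim_compose[OF tendsto_inverse_0])
    then have "(\<lambda>n. \<bar>t\<bar> ^ 3 * inverse (s n) + t ^ 4 * (inverse (s n))\<^sup>2) \<longlonglongrightarrow> \<bar>t\<bar> ^ 3 * 0 + t ^ 4 * 0\<^sup>2"
      by (intro tendsto_intros)
    then show ?thesis by (simp add: divide_inverse power_inverse)
  qed
  ultimately have "(\<lambda>n. (\<Prod>i<n. iexp (- (t / s n * p n i)) * (1 - p n i + p n i * iexp (t / s n)))
      - of_real (exp (- t\<^sup>2 / 2))) \<longlonglongrightarrow> 0"
    by (rule Lim_null_comparison)
  then show ?thesis by (simp only: LIM_zero_iff)
qed

section \<open>Mean, variance and asymptotic normality\<close>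

context triangle
begin

text \<open>Each factor \<open>(w + r) / (1 + r)\<close> of \<open>P_n(w) / P_n(1)\<close> equals
  \<open>1 - p + p w\<close> with this value as \<open>p\<close>, the generating function of a
  Bernoulli variable.\<close>

definition success :: "nat \<Rightarrow> nat \<Rightarrow> real" where
  "success n i = 1 / (1 + neg_root n i)"

lemma success_bounds: "i < n \<Longrightarrow> 0 \<le> success n i \<and> success n i \<le> 1"
  using neg_root_pos[of i n] by (simp add: success_def)

lemma success_variance: "i < n \<Longrightarrow> success n i * (1 - success n i) = neg_root n i / (1 + neg_root n i)\<^sup>2"
  using neg_root_pos[of i n] by (simp add: success_def power2_eq_square field_simps)

lemma sum_success: "(\<lambda>n. (\<Sum>i<n. success n i) / real n powr \<kappa>) \<longlonglongrightarrow> J 1"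
  using sum_inverse_limit by (simp add: success_def)

lemma sum_success_variance:
  "(\<lambda>n. (\<Sum>i<n. success n i * (1 - success n i)) / real n powr \<kappa>) \<longlonglongrightarrow> J 1 * (1 - \<kappa>)"
  using sum_variance_limit by (simp add: success_variance)

section \<open>Moments from derivatives of the row polynomial at 1\<close>

lemma row_poly_eq:
  "(\<Sum>k\<le>n. monom (T n k) k) = smult (T n n) (\<Prod>i<n. [:neg_root n i, 1:])"
proof (rule poly_eq_poly_eq_iff[THEN iffD1], rule ext)
  fix x :: real
  show "poly (\<Sum>k\<le>n. monom (T n k) k) x = poly (smult (T n n) (\<Prod>i<n. [:neg_root n i, 1:])) x"
    using row_sum_factor[of n x] by (simp add: poly_sum poly_monom poly_prod row_sum_def add.commute)
qed

lemma row_moment_1: "(\<Sum>k\<le>n. real k * T n k) = row_sum n 1 * (\<Sum>i<n. success n i)"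
proof -
  have "(\<Sum>k\<le>n. real k * T n k) = poly (pderiv (\<Sum>k\<le>n. monom (T n k) k)) 1"
    by (simp add: higher_pderiv_sum[where n = 1, simplified] pderiv_monom poly_sum poly_monom)
  also have "\<dots> = T n n * (poly (\<Prod>i<n. [:neg_root n i, 1:]) 1 * (\<Sum>i<n. 1 / (1 + neg_root n i)))"
    unfolding row_poly_eq pderiv_smult poly_smult
    by (subst poly_pderiv_prod_linear) (auto dest!: neg_root_pos)
  finally show ?thesis by (simp add: row_sum_factor success_def poly_prod add.commute)
qed

text \<open>The second derivative at 1 gives the second factorial moment; the truncated
  \<open>k - 1\<close> at \<open>k = 0\<close> is harmless because of the factor
  \<open>k\<close>.\<close>

lemma row_moment_2: "(\<Sum>k\<le>n. real (k - 1) * (real k * T n k))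
  = row_sum n 1 * ((\<Sum>i<n. success n i)\<^sup>2 - (\<Sum>i<n. (success n i)\<^sup>2))"
proof -
  have "(\<Sum>k\<le>n. real (k - 1) * (real k * T n k)) = poly (pderiv (pderiv (\<Sum>k\<le>n. monom (T n k) k))) 1"
    by (simp add: higher_pderiv_sum[where n = 1, simplified] pderiv_monom poly_sum poly_monom)
  also have "\<dots> = T n n * (poly (\<Prod>i<n. [:neg_root n i, 1:]) 1
      * ((\<Sum>i<n. 1 / (1 + neg_root n i))\<^sup>2 - (\<Sum>i<n. 1 / (1 + neg_root n i)\<^sup>2)))"
    unfolding row_poly_eq pderiv_smult poly_smult
    by (subst poly_pderiv2_prod_linear) (auto dest!: neg_root_pos)
  finally show ?thesis
    by (simp add: row_sum_factor success_def poly_prod power_divide add.commute)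
qed

lemma J_1: "J 1 = \<gamma>' powr (\<alpha> / (\<alpha> + \<beta>)) / \<beta> * \<alpha> powr \<kappa>"
proof -
  have 1: "1 - \<kappa> = \<alpha> / (\<alpha> + \<beta>)" using pos by (simp add: \<kappa>_def field_simps)
  have "J 1 = (\<gamma>' / \<beta>) powr (1 - \<kappa>) * (\<beta> / \<alpha>) powr (- \<kappa>)"
    by (simp add: J_def a_def)
  also have "\<dots> = \<gamma>' powr (1 - \<kappa>) / \<beta> powr (1 - \<kappa>) * (\<alpha> powr \<kappa> / \<beta> powr \<kappa>)"
    using pos by (simp add: powr_divide powr_minus)
  also have "\<dots> = \<gamma>' powr (1 - \<kappa>) / (\<beta> powr (1 - \<kappa>) * \<beta> powr \<kappa>) * \<alpha> powr \<kappa>"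
    by simp
  also have "\<beta> powr (1 - \<kappa>) * \<beta> powr \<kappa> = \<beta>"
    using pos by (simp add: powr_add[symmetric])
  finally show ?thesis by (simp add: 1)
qed

lemma J_1_powr: "J 1 * real n powr \<kappa> = \<gamma>' powr (\<alpha> / (\<alpha> + \<beta>)) / \<beta> * (\<alpha> * real n) powr (\<beta> / (\<alpha> + \<beta>))"
  using pos by (simp add: J_1 powr_mult \<kappa>_def)

lemma J_1_powr': "J 1 * (1 - \<kappa>) * real n powr \<kappa>
  = \<gamma>' powr (\<alpha> / (\<alpha> + \<beta>)) * \<alpha> * (\<alpha> * real n) powr (\<beta> / (\<alpha> + \<beta>)) / (\<beta> * (\<alpha> + \<beta>))"
proof -
  have "1 - \<kappa> = \<alpha> / (\<alpha> + \<beta>)" using pos by (simp add: \<kappa>_def field_simps)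
  then have "J 1 * (1 - \<kappa>) * real n powr \<kappa> = (J 1 * real n powr \<kappa>) * (\<alpha> / (\<alpha> + \<beta>))" by simp
  then show ?thesis unfolding J_1_powr by (simp add: mult_ac)
qed

end

lemma asymp_equiv_of_tendsto_ratio:
  fixes f :: "nat \<Rightarrow> real"
  assumes "(\<lambda>n. f n / real n powr k) \<longlonglongrightarrow> L" "L \<noteq> 0"
  shows "f \<sim>[sequentially] (\<lambda>n. L * real n powr k)"
proof (rule asymp_equivI')
  have "(\<lambda>n. f n / real n powr k / L) \<longlonglongrightarrow> L / L"
    using assms by (intro tendsto_intros)
  then show "(\<lambda>n. f n / (L * real n powr k)) \<longlonglongrightarrow> 1"
    using assms(2) by (simp add: mult.commute)
qed

theorem theorem6:
  fixes \<alpha> \<beta> \<gamma> \<gamma>' :: real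
    and M :: "nat \<Rightarrow> 'a measure"
    and X :: "nat \<Rightarrow> 'a \<Rightarrow> int"
    and \<mu> \<sigma> :: "nat \<Rightarrow> real"
  assumes "\<alpha> > 0" and "\<beta> > 0" and "\<gamma> \<ge> 0" and "\<gamma>' > 0"
    and "\<And>n. prob_space (M n)"
    and "\<And>n. X n \<in> measurable (M n) (count_space UNIV)"
    and "\<And>n k. k \<le> n \<Longrightarrow>
           measure (M n) {\<omega> \<in> space (M n). X n \<omega> = int k} =
             tri \<alpha> \<beta> \<gamma> 0 0 \<gamma>' n k / (\<Sum>j=0..n. tri \<alpha> \<beta> \<gamma> 0 0 \<gamma>' n j)"
    and "\<And>n. \<mu> n = prob_space.expectation (M n) (\<lambda>\<omega>. real_of_int (X n \<omega>))"
    and "\<And>n. \<sigma> n = sqrt (prob_space.variance (M n) (\<lambda>\<omega>. real_of_int (X n \<omega>)))"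
  shows "weak_conv_m (\<lambda>n. distr (M n) borel (\<lambda>\<omega>. (real_of_int (X n \<omega>) - \<mu> n) / \<sigma> n))
           std_normal_distribution
       \<and> \<mu> \<sim>[sequentially]
           (\<lambda>n. \<gamma>' powr (\<alpha> / (\<alpha> + \<beta>)) / \<beta> * (\<alpha> * real n) powr (\<beta> / (\<alpha> + \<beta>)))
       \<and> (\<lambda>n. (\<sigma> n)\<^sup>2) \<sim>[sequentially]
           (\<lambda>n. \<gamma>' powr (\<alpha> / (\<alpha> + \<beta>)) * \<alpha> * (\<alpha> * real n) powr (\<beta> / (\<alpha> + \<beta>))
                  / (\<beta> * (\<alpha> + \<beta>)))"
proof -
  interpret triangle \<alpha> \<beta> \<gamma> \<gamma>' by unfold_locales fact+
  note X = assms(6)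
  define q where "q n k = T n k / row_sum n 1" for n k
  define Y where "Y n \<omega> = (real_of_int (X n \<omega>) - \<mu> n) / \<sigma> n" for n \<omega>
  have S: "row_sum n 1 > 0" for n by (rule row_sum_pos) simp
  have q: "measure (M n) {\<omega> \<in> space (M n). X n \<omega> = int k} = q n k" if "k \<le> n" for n k
    using assms(7)[OF that] by (simp add: q_def row_sum_def atLeast0AtMost)
  have q_sum: "(\<Sum>k\<le>n. q n k) = 1" for n
    using S[of n] by (simp add: q_def sum_divide_distrib[symmetric]) (simp add: row_sum_def)
  note fin = prob_space.integral_finitely_supported[OF assms(5) X q q_sum]

  \<comment> \<open>The mean is exactly the sum of the success probabilities; asymptotics enter only
    through \<open>sum_success\<close>.\<close>
  have \<mu>: "\<mu> n = (\<Sum>i<n. success n i)" for n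
  proof -
    have "\<mu> n = (\<Sum>k\<le>n. q n k *\<^sub>R real_of_int (int k))"
      by (rule trans[OF assms(8) fin(1)[where f = real_of_int]])
    then have "\<mu> n = (\<Sum>k\<le>n. real k * T n k) / row_sum n 1"
      by (simp add: q_def sum_divide_distrib mult.commute)
    then show ?thesis unfolding row_moment_1 using S[of n] by simp
  qed
  have \<sigma>2: "prob_space.variance (M n) (\<lambda>\<omega>. real_of_int (X n \<omega>)) = (\<Sum>i<n. success n i * (1 - success n i))" for n
  proof -
    interpret prob_space "M n" by fact
    have "expectation (\<lambda>\<omega>. (real_of_int (X n \<omega>))\<^sup>2) = (\<Sum>k\<le>n. q n k *\<^sub>R (real_of_int (int k))\<^sup>2)"
      by (rule fin(1)[where f = "\<lambda>x. (real_of_int x)\<^sup>2"])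
    also have "\<dots> = (\<Sum>k\<le>n. real k ^ 2 * T n k) / row_sum n 1"
      by (simp add: q_def sum_divide_distrib mult.commute)
    \<comment> \<open>The second moment splits into the second factorial moment and the
      mean.\<close>
    also have "(\<Sum>k\<le>n. real k ^ 2 * T n k) = (\<Sum>k\<le>n. real (k - 1) * (real k * T n k)) + (\<Sum>k\<le>n. real k * T n k)"
      unfolding sum.distrib[symmetric]
    proof (intro sum.cong refl)
      fix k show "real k ^ 2 * T n k = real (k - 1) * (real k * T n k) + real k * T n k"
        by (cases k) (simp_all add: power2_eq_square algebra_simps)
    qed
    also have "\<dots> / row_sum n 1
      = (\<Sum>i<n. success n i)\<^sup>2 - (\<Sum>i<n. (success n i)\<^sup>2) + (\<Sum>i<n. success n i)"
      unfolding row_moment_1 row_moment_2 using S[of n] by (simp add: add_divide_distrib)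
    finally have E2: "expectation (\<lambda>\<omega>. (real_of_int (X n \<omega>))\<^sup>2) = \<dots>" .
    have "variance (\<lambda>\<omega>. real_of_int (X n \<omega>))
      = expectation (\<lambda>\<omega>. (real_of_int (X n \<omega>))\<^sup>2) - (\<mu> n)\<^sup>2"
      unfolding assms(8) by (intro variance_eq fin(2)) auto
    then show ?thesis
      unfolding E2 \<mu> by (simp add: sum_subtractf algebra_simps power2_eq_square)
  qed
  have var_nonneg: "(\<Sum>i<n. success n i * (1 - success n i)) \<ge> 0" for n
    using success_bounds by (intro sum_nonneg) auto
  have \<sigma>_sq: "(\<sigma> n)\<^sup>2 = (\<Sum>i<n. success n i * (1 - success n i))" for n
    unfolding assms(9) \<sigma>2 using var_nonneg by simp
  have \<sigma>_nonneg: "\<sigma> n \<ge> 0" for n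
    unfolding assms(9) \<sigma>2 using var_nonneg by simp

  have J: "J 1 > 0" "J 1 * (1 - \<kappa>) > 0" using J_pos[of 1] \<kappa>_less_1 by auto
  have "\<mu> \<sim>[sequentially] (\<lambda>n. J 1 * real n powr \<kappa>)"
    unfolding \<mu>[abs_def] using sum_success J by (intro asymp_equiv_of_tendsto_ratio) auto
  moreover have \<sigma>_equiv: "(\<lambda>n. (\<sigma> n)\<^sup>2) \<sim>[sequentially] (\<lambda>n. J 1 * (1 - \<kappa>) * real n powr \<kappa>)"
    unfolding \<sigma>_sq using sum_success_variance J by (intro asymp_equiv_of_tendsto_ratio) auto
  moreover have "weak_conv_m (\<lambda>n. distr (M n) borel (Y n)) std_normal_distribution"
  proof (rule levy_continuity)
    have Y: "Y n \<in> borel_measurable (M n)" for n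
      unfolding Y_def using X[of n] by measurable
    show "real_distribution (distr (M n) borel (Y n))" for n
      using prob_space.real_distribution_distr[OF assms(5) Y] .
    show "real_distribution std_normal_distribution" by (rule real_dist_normal_dist)
    fix t :: real
    \<comment> \<open>The variance tends to infinity because \<open>\<kappa> > 0\<close>; this is
      the condition for the Bernoulli limit.\<close>
    have "filterlim (\<lambda>n. (\<sigma> n)\<^sup>2) at_top sequentially"
    proof (rule asymp_equiv_at_top_transfer[OF asymp_equiv_symI[OF \<sigma>_equiv]])
      show "filterlim (\<lambda>n. J 1 * (1 - \<kappa>) * real n powr \<kappa>) at_top sequentially"
        using J(2) \<kappa>_pos by real_asymp
    qed
    then have "filterlim (\<lambda>n. sqrt ((\<sigma> n)\<^sup>2)) at_top sequentially"
      by (rule filterlim_compose[OF sqrt_at_top])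
    then have \<sigma>_top: "filterlim \<sigma> at_top sequentially"
      using \<sigma>_nonneg by simp
    \<comment> \<open>The characteristic function is \<open>P_n(exp (i u)) / P_n(1)\<close> times a
      centring phase; both split into one factor per zero.\<close>
    have "char (distr (M n) borel (Y n)) t
      = (\<Prod>i<n. iexp (- (t / \<sigma> n * success n i)) * (1 - success n i + success n i * iexp (t / \<sigma> n)))" for n
    proof -
      define u where "u = t / \<sigma> n"
      have "char (distr (M n) borel (Y n)) t = prob_space.expectation (M n) (\<lambda>\<omega>. iexp (t * Y n \<omega>))"
        unfolding char_def using Y by (subst integral_distr) auto
      also have "(\<lambda>\<omega>. iexp (t * Y n \<omega>)) = (\<lambda>\<omega>. iexp (- (u * \<mu> n)) * iexp (u * real_of_int (X n \<omega>)))"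
        by (simp add: Y_def u_def exp_add[symmetric] diff_divide_distrib algebra_simps)
      also have "prob_space.expectation (M n) \<dots> = (\<Sum>k\<le>n. q n k *\<^sub>R (iexp (- (u * \<mu> n)) * iexp (u * real_of_int (int k))))"
        by (rule fin(1)[where f = "\<lambda>x. iexp (- (u * \<mu> n)) * iexp (u * real_of_int x)"]) auto
      also have "\<dots> = iexp (- (u * \<mu> n)) / of_real (row_sum n 1) * (\<Sum>k\<le>n. of_real (T n k) * iexp u ^ k)"
        by (simp add: q_def scaleR_conv_of_real sum_distrib_left exp_of_nat_mult[symmetric] mult_ac)
      also have "\<dots> = iexp (- (u * \<mu> n)) * (of_real (T n n) * (\<Prod>i<n. iexp u + of_real (neg_root n i)) / of_real (T n n * (\<Prod>i<n. 1 + neg_root n i)))"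
        unfolding row_poly_factor row_sum_factor by simp
      also have "of_real (T n n) * (\<Prod>i<n. iexp u + of_real (neg_root n i)) / of_real (T n n * (\<Prod>i<n. 1 + neg_root n i))
        = (\<Prod>i<n. (iexp u + of_real (neg_root n i)) / of_real (1 + neg_root n i))"
        using T_diag_pos[of n] by (simp add: prod_dividef)
      also have "\<dots> = (\<Prod>i<n. 1 - success n i + success n i * iexp u)"
      proof (intro prod.cong refl)
        fix i assume "i \<in> {..<n}"
        then have r: "complex_of_real (1 + neg_root n i) \<noteq> 0"
          using neg_root_pos[of i n] unfolding of_real_eq_0_iff by simp
        have "complex_of_real (success n i) = 1 / of_real (1 + neg_root n i)"
          by (simp add: success_def)
        then show "(iexp u + of_real (neg_root n i)) / of_real (1 + neg_root n i) = 1 - success n i + success n i * iexp u"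
          using r by (simp only:) (simp add: field_simps)
      qed
      also have "iexp (- (u * \<mu> n)) = (\<Prod>i<n. iexp (- (u * success n i)))"
        unfolding \<mu> by (simp add: exp_sum[symmetric] sum_distrib_left sum_negf)
      finally show ?thesis by (simp add: prod.distrib u_def)
    qed
    moreover have "char std_normal_distribution t = of_real (exp (- t\<^sup>2 / 2))"
      by (simp add: char_std_normal_distribution)
    ultimately show "(\<lambda>n. char (distr (M n) borel (Y n)) t) \<longlonglongrightarrow> char std_normal_distribution t"
      using bernoulli_sum_char_limit[of success \<sigma> t] success_bounds \<sigma>_sq \<sigma>_nonneg \<sigma>_top by simp
  qed
  ultimately show ?thesis
    unfolding J_1_powr J_1_powr' Y_def by blast
qed

end
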